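(* Let $m,n\ge 3$ be integers and let $K_m\times C_n$ be the Cartesian product of the complete graph $K_m$ on $m$ vertices and the cycle $C_n$ on $n$ vertices. Let $K(K_m\times C_n)$ be its critical group. (1) If $n=2s+1$, then $$K(K_m\times C_n)\;\cong\;\mathbb{Z}_{\gcd(n,g_s)}\oplus \mathbb{Z}_{h_s}\oplus \underbrace{\mathbb{Z}_{h_s}\oplus\cdots\oplus \mathbb{Z}_{h_s}}_{m-2}\oplus\, \mathbb{Z}_{\gamma}\oplus\underbrace{\mathbb{Z}_{mh_s}\oplus\cdots\oplus\mathbb{Z}_{mh_s}}_{m-3}\oplus\, \mathbb{Z}_{\varphi},$$ where $\gamma=\dfrac{h_s}{\gcd(n,g_s)}\gcd(n,h_s)$ and $\varphi=\dfrac{nmh_s}{\gcd(n,h_s)}$. (2) If $n=2s$, then $$K(K_m\times C_n)\;\cong\;\mathbb{Z}_{\gcd(u_s,2\tau_s)}\oplus \mathbb{Z}_{\zeta}\oplus \underbrace{\mathbb{Z}_{\gcd(m,2)u_s}\oplus\cdots\oplus \mathbb{Z}_{\gcd(m,2)u_s}}_{m-3}\oplus\, \mathbb{Z}_{\eta}\oplus \mathbb{Z}_{\rho}\oplus\underbrace{\mathbb{Z}_{\chi}\oplus\cdots\oplus\mathbb{Z}_{\chi}}_{m-3}\oplus\, \mathbb{Z}_{\xi},$$ where $$\zeta=\frac{u_s\gcd(n,u_s,4\tau_s)}{\gcd(u_s,2\tau_s)},\qquad \eta=\frac{u_s\gcd(m,2)\gcd(n,u_s-4\tau_s)}{\gcd(n,u_s,4\tau_s)},$$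 $$\rho=\frac{(m+4)u_s\gcd\bigl(mn,(m+4)u_s,2n\bigr)}{\gcd(n,u_s-4\tau_s)\gcd(m,2)},\qquad \chi=\frac{m(m+4)u_s}{\gcd(m,2)},\qquad \xi=\frac{nm(m+4)u_s}{\gcd\bigl(mn,(m+4)u_s,2n\bigr)}.$$
   Context: For a positive integer $m$ put $\alpha=\frac12(m+2+\sqrt{m^2+4m})$ and $\beta=\frac12(m+2-\sqrt{m^2+4m})$. For $p\in\mathbb{Z}$ define $u_p=\frac{\alpha^p-\beta^p}{\alpha-\beta}$, $\tau_p=\frac1m(p-u_p)$, $h_p=u_p+u_{p+1}$, $g_p=\tau_p+\tau_{p+1}$ (all of these are integers). Here $\mathbb{Z}_k=\mathbb{Z}/k\mathbb{Z}$, and $\gcd$ denotes the (nonnegative) greatest common divisor. The Cartesian product $G_1\times G_2$ of graphs $G_1=(V_1,E_1)$, $G_2=(V_2,E_2)$ has vertex set $V_1\times V_2$, and $(u_1,v_1)$ is adjacent to $(u_2,v_2)$ if and only if either $u_1=u_2$ and $(v_1,v_2)\in E_2$, or $(u_1,u_2)\in E_1$ and $v_1=v_2$. For a finite connected graph $G=(V,E)$ without loops, the Laplacian matrix $L(G)$ is the $|V|\times|V|$ integer matrix with $L(G)_{uu}=d(u)$ (the degree of $u$) and $L(G)_{uv}=-a_{uv}$ for $u\neq v$, where $a_{uv}$ is the number of edges joining $u$ and $v$. Its Smith normal form is $\mathrm{diag}(t_1,\dots,t_{|V|-1},0)$ with $t_i$ positive integers, $t_i\mid t_{i+1}$, so that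 $\mathbb{Z}^{|V|}/\mathrm{im}\,L(G)\cong\mathbb{Z}\oplus K(G)$, where the critical group is the finite abelian group $K(G)=\bigoplus_{i=1}^{|V|-1}\mathbb{Z}/t_i\mathbb{Z}$ (equivalently, up to isomorphism, the torsion subgroup of the cokernel of $L(G)$). *)

theory Defs
  imports
    Complex_Main
    "HOL-Algebra.Product_Groups"
    "Graph_Theory.Digraph_Component"
begin

section \<open>Critical groups\<close>

text \<open>
  As usual in \<^theory>\<open>Graph_Theory.Digraph\<close>, an undirected graph is a symmetric digraph: an
  undirected edge between \<open>u\<close> and \<open>v\<close> is represented by one arc from \<open>u\<close> to \<open>v\<close> together with one
  arc from \<open>v\<close> to \<open>u\<close>. Hence the degree of \<open>u\<close> is its out-degree, and the number of edges joining
  \<open>u\<close> and \<open>v\<close> is the number of arcs from \<open>u\<close> to \<open>v\<close>.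
\<close>

definition laplacian :: "('a, 'b) pre_digraph \<Rightarrow> 'a \<Rightarrow> 'a \<Rightarrow> int" where
  "laplacian G u v =
     (if u = v then int (out_degree G u)
      else - int (card {e \<in> arcs G. tail G e = u \<and> head G e = v}))"

definition vertex_lattice :: "('a, 'b) pre_digraph \<Rightarrow> ('a \<Rightarrow> int) monoid" where
  "vertex_lattice G = product_group (verts G) (\<lambda>_. integer_group)"

definition laplacian_image :: "('a, 'b) pre_digraph \<Rightarrow> ('a \<Rightarrow> int) set" where
  "laplacian_image G =
     (\<lambda>x. \<lambda>u\<in>verts G. \<Sum>v\<in>verts G. laplacian G u v * x v) ` carrier (vertex_lattice G)"

definition laplacian_cokernel :: "('a, 'b) pre_digraph \<Rightarrow> ('a \<Rightarrow> int) set monoid" where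
  "laplacian_cokernel G = vertex_lattice G Mod laplacian_image G"

definition torsion_subgroup :: "('a, 'c) monoid_scheme \<Rightarrow> ('a, 'c) monoid_scheme" where
  "torsion_subgroup A =
     A\<lparr>carrier := {x \<in> carrier A. \<exists>k::nat. k > 0 \<and> x [^]\<^bsub>A\<^esub> k = \<one>\<^bsub>A\<^esub>}\<rparr>"

definition critical_group :: "('a, 'b) pre_digraph \<Rightarrow> ('a \<Rightarrow> int) set monoid" where
  "critical_group G = torsion_subgroup (laplacian_cokernel G)"

text \<open>
  The direct sum of the groups \<open>\<int>/k\<int>\<close>, one summand for each entry \<open>k\<close> of the list.
\<close>

definition cyclic_sum :: "int list \<Rightarrow> (nat \<Rightarrow> int) monoid" where
  "cyclic_sum ks =
     sum_group {..<length ks} (\<lambda>i. integer_mod_group (nat \<bar>ks ! i\<bar>))"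


section \<open>The graphs\<close>

definition complete_graph :: "nat \<Rightarrow> nat pair_pre_digraph" where
  "complete_graph m =
     \<lparr>pverts = {..<m}, parcs = {(i, j). i < m \<and> j < m \<and> i \<noteq> j}\<rparr>"

text \<open>For \<open>n < 3\<close> the following is not a cycle; it is only used for \<open>n \<ge> 3\<close>.\<close>

definition cycle_graph :: "nat \<Rightarrow> nat pair_pre_digraph" where
  "cycle_graph n =
     \<lparr>pverts = {..<n},
      parcs = {(i, j). i < n \<and> j < n \<and> (j = Suc i mod n \<or> i = Suc j mod n)}\<rparr>"

definition cartesian_product ::
  "'a pair_pre_digraph \<Rightarrow> 'b pair_pre_digraph \<Rightarrow> ('a \<times> 'b) pair_pre_digraph" where
  "cartesian_product G H =
     \<lparr>pverts = pverts G \<times> pverts H,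
      parcs = {((a, b), (c, d)).
         (a = c \<and> a \<in> pverts G \<and> (b, d) \<in> parcs H) \<or>
         ((a, c) \<in> parcs G \<and> b = d \<and> b \<in> pverts H)}\<rparr>"

lemma pair_graph_complete_graph: "pair_graph (complete_graph m)"
proof
  show "finite (parcs (complete_graph m))"
    by (rule finite_subset[of _ "{..<m} \<times> {..<m}"]) (auto simp: complete_graph_def)
qed (auto simp: complete_graph_def symmetric_def sym_def)

lemma pair_graph_cycle_graph:
  assumes "n \<ge> 2"
  shows "pair_graph (cycle_graph n)"
proof
  show "finite (parcs (cycle_graph n))"
    by (rule finite_subset[of _ "{..<n} \<times> {..<n}"]) (auto simp: cycle_graph_def)
next
  fix e assume "e \<in> parcs (cycle_graph n)"
  moreover have "Suc i mod n \<noteq> i" if "i < n" for i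
    using assms that by (cases "Suc i = n") auto
  ultimately show "fst e \<noteq> snd e"
    by (cases e) (force simp: cycle_graph_def)
qed (auto simp: cycle_graph_def symmetric_def sym_def)

lemma pair_graph_cartesian_product:
  assumes "pair_graph G" "pair_graph H"
  shows "pair_graph (cartesian_product G H)"
proof -
  interpret G: pair_graph G by fact
  interpret H: pair_graph H by fact
  have sub: "parcs (cartesian_product G H) \<subseteq>
      (pverts G \<times> pverts H) \<times> (pverts G \<times> pverts H)"
    by (auto simp: cartesian_product_def dest: G.wellformed' H.wellformed')
  show ?thesis
  proof
    show "finite (parcs (cartesian_product G H))"
      by (rule finite_subset[OF sub]) (simp add: G.pair_finite_verts H.pair_finite_verts)
    show "finite (pverts (cartesian_product G H))"
      by (simp add: cartesian_product_def G.pair_finite_verts H.pair_finite_verts)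
    show "symmetric (with_proj (cartesian_product G H))"
      using G.pair_sym_arcs H.pair_sym_arcs
      by (auto simp: cartesian_product_def symmetric_def sym_def)
  next
    fix e assume e: "e \<in> parcs (cartesian_product G H)"
    with sub have "e \<in> (pverts G \<times> pverts H) \<times> (pverts G \<times> pverts H)"
      by blast
    then show "fst e \<in> pverts (cartesian_product G H)" "snd e \<in> pverts (cartesian_product G H)"
      by (auto simp: cartesian_product_def)
    from e show "fst e \<noteq> snd e"
      by (auto simp: cartesian_product_def dest: G.pair_no_loops H.pair_no_loops)
  qed
qed


section \<open>The sequences\<close>

definition alpha :: "nat \<Rightarrow> real" where
  "alpha m = (real m + 2 + sqrt (real m ^ 2 + 4 * real m)) / 2"

definition beta :: "nat \<Rightarrow> real" where
  "beta m = (real m + 2 - sqrt (real m ^ 2 + 4 * real m)) / 2"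

text \<open>
  The sequences are needed as integers, since gcds of their values are formed. Rounding and
  integer division are exact here: see \<open>of_int_u_seq\<close> and \<open>of_int_tau_seq\<close> below.
\<close>

definition u_seq :: "nat \<Rightarrow> int \<Rightarrow> int" where
  "u_seq m p = \<lfloor>(alpha m powi p - beta m powi p) / (alpha m - beta m)\<rfloor>"

definition tau_seq :: "nat \<Rightarrow> int \<Rightarrow> int" where
  "tau_seq m p = (p - u_seq m p) div int m"

definition h_seq :: "nat \<Rightarrow> int \<Rightarrow> int" where
  "h_seq m p = u_seq m p + u_seq m (p + 1)"

definition g_seq :: "nat \<Rightarrow> int \<Rightarrow> int" where
  "g_seq m p = tau_seq m p + tau_seq m (p + 1)"

lemma alpha_times_beta: "alpha m * beta m = 1"
proof -
  have "alpha m * beta m = ((real m + 2)\<^sup>2 - (sqrt (real m ^ 2 + 4 * real m))\<^sup>2) / 4"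
    unfolding alpha_def beta_def by (simp add: power2_eq_square algebra_simps)
  also have "\<dots> = 1"
    by (simp add: power2_eq_square algebra_simps)
  finally show ?thesis .
qed

lemma alpha_plus_beta: "alpha m + beta m = real m + 2"
  by (simp add: alpha_def beta_def field_simps)

lemma u_seq_exact_aux:
  assumes m: "m > 0"
  shows "\<exists>z::int. (alpha m powi p - beta m powi p) / (alpha m - beta m) = of_int z
           \<and> int m dvd p - z" (is "?P p")
proof -
  define f where "f p = (alpha m powi p - beta m powi p) / (alpha m - beta m)" for p :: int
  have nz: "alpha m \<noteq> 0" "beta m \<noteq> 0"
    using alpha_times_beta[of m] by auto
  have "sqrt (real m ^ 2 + 4 * real m) > 0"
    using m by (simp add: add_nonneg_pos)
  then have d: "alpha m - beta m \<noteq> 0"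
    unfolding alpha_def beta_def by (simp add: field_simps)
  have quad: "x powi (q + 1) = (real m + 2) * x powi q - x powi (q - 1)"
    if "x = alpha m \<or> x = beta m" for x q
  proof -
    have x: "x \<noteq> 0" and x2: "x * x = (real m + 2) * x - 1"
      using that nz alpha_times_beta[of m] alpha_plus_beta[of m, symmetric]
      by (auto simp: algebra_simps)
    have "x powi (q + 1) = x powi (q - 1) * (x * x)"
      using x by (simp add: power_int_add power_int_diff)
    also have "\<dots> = (real m + 2) * (x powi (q - 1) * x) - x powi (q - 1)"
      unfolding x2 by (simp add: algebra_simps)
    also have "x powi (q - 1) * x = x powi q"
      using x by (simp add: power_int_diff)
    finally show ?thesis .
  qed
  have rec: "f (q + 1) = (real m + 2) * f q - f (q - 1)" for q
  proof -
    have "alpha m powi (q + 1) - beta m powi (q + 1) =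
        (real m + 2) * (alpha m powi q - beta m powi q) - (alpha m powi (q - 1) - beta m powi (q - 1))"
      using quad[of "alpha m" q] quad[of "beta m" q] by (simp add: algebra_simps)
    then show ?thesis
      unfolding f_def by (simp only: diff_divide_distrib times_divide_eq_right right_diff_distrib)
  qed
  define Q where "Q p \<longleftrightarrow> (\<exists>z::int. f p = of_int z \<and> int m dvd p - z)" for p
  have base: "Q 0" "Q 1"
    unfolding Q_def f_def using d by (auto intro: exI[of _ 0] exI[of _ 1])
  have up: "Q (q + 1)" if "Q q" "Q (q - 1)" for q
  proof -
    from that obtain y z where y: "f q = of_int y" "int m dvd q - y"
      and z: "f (q - 1) = of_int z" "int m dvd q - 1 - z"
      unfolding Q_def by auto
    have "int m dvd 2 * (q - y) - (q - 1 - z) - int m * y"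
      by (rule dvd_diff[OF dvd_diff[OF dvd_mult[OF y(2)] z(2)] dvd_triv_left])
    then have "int m dvd q + 1 - ((int m + 2) * y - z)"
      by (simp add: algebra_simps)
    then show ?thesis
      unfolding Q_def using rec[of q] y(1) z(1)
      by (intro exI[of _ "(int m + 2) * y - z"]) simp
  qed
  have down: "Q (q - 1)" if "Q q" "Q (q + 1)" for q
  proof -
    from that obtain y z where y: "f q = of_int y" "int m dvd q - y"
      and z: "f (q + 1) = of_int z" "int m dvd q + 1 - z"
      unfolding Q_def by auto
    have "int m dvd 2 * (q - y) - (q + 1 - z) - int m * y"
      by (rule dvd_diff[OF dvd_diff[OF dvd_mult[OF y(2)] z(2)] dvd_triv_left])
    then have "int m dvd q - 1 - ((int m + 2) * y - z)"
      by (simp add: algebra_simps)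
    then show ?thesis
      unfolding Q_def using rec[of q] y(1) z(1)
      by (intro exI[of _ "(int m + 2) * y - z"]) simp
  qed
  have "Q p \<and> Q (p + 1)"
  proof (induction p rule: int_induct[where k = 0])
    case base
    show ?case using \<open>Q 0\<close> \<open>Q 1\<close> by simp
  next
    case (step1 i)
    then show ?case using up[of "i + 1"] by simp
  next
    case (step2 i)
    then show ?case using down[of i] by simp
  qed
  then show ?thesis
    by (simp add: Q_def f_def)
qed

lemma of_int_u_seq:
  assumes "m > 0"
  shows "of_int (u_seq m p) = (alpha m powi p - beta m powi p) / (alpha m - beta m)"
  using u_seq_exact_aux[OF assms, of p] by (auto simp: u_seq_def)

lemma m_times_tau_seq:
  assumes "m > 0"
  shows "int m * tau_seq m p = p - u_seq m p"
  using u_seq_exact_aux[OF assms, of p] by (auto simp: u_seq_def tau_seq_def)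

lemma of_int_tau_seq:
  assumes "m > 0"
  shows "of_int (tau_seq m p) = (of_int p - of_int (u_seq m p)) / real m"
proof -
  have "real m * of_int (tau_seq m p) = of_int p - of_int (u_seq m p)"
    using arg_cong[OF m_times_tau_seq[OF assms, of p], of real_of_int] by simp
  then show ?thesis
    using assms by (simp add: field_simps)
qed

text \<open>
  The two quotients in the theorem whose integrality is not immediate: the divisor does not
  visibly divide a factor of the dividend.
\<close>

lemma gamma_quotient_exact:
  assumes "m > 0" "n = 2 * int s + 1"
  shows "gcd n (g_seq m (int s)) dvd h_seq m (int s)"
proof -
  have "h_seq m (int s) = n - int m * g_seq m (int s)"
    using m_times_tau_seq[OF assms(1), of "int s"] m_times_tau_seq[OF assms(1), of "int s + 1"] assms(2)
    by (simp add: h_seq_def g_seq_def algebra_simps)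
  then show ?thesis
    by (metis dvd_diff dvd_mult gcd_dvd1 gcd_dvd2)
qed

lemma rho_quotient_exact:
  fixes n :: int and m s :: nat
  defines "u \<equiv> u_seq m (int s)" and "t \<equiv> tau_seq m (int s)"
  assumes "m > 0" "n = 2 * int s"
  shows "gcd n (u - 4 * t) * gcd (int m) 2 dvd
     (int m + 4) * u * gcd (int m * n) (gcd ((int m + 4) * u) (2 * n))"
proof (rule mult_dvd_mono)
  have "(int m + 4) * u = int m * (u - 4 * t) + 2 * n"
    using m_times_tau_seq[OF assms(3), of "int s"] assms(4)
    by (simp add: u_def t_def algebra_simps)
  then show "gcd n (u - 4 * t) dvd (int m + 4) * u"
    by (metis dvd_add dvd_mult gcd_dvd1 gcd_dvd2)
  have "gcd (int m) 2 dvd int m" "gcd (int m) 2 dvd 2" "gcd (int m) 2 dvd int m + 4"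
    by (auto intro!: dvd_add intro: dvd_trans[of _ 2])
  then show "gcd (int m) 2 dvd gcd (int m * n) (gcd ((int m + 4) * u) (2 * n))"
    by (intro gcd_greatest dvd_mult2)
qed

end

theory Submission
  imports Defs "HOL-Library.Function_Algebras" "HOL-Library.Product_Plus"
    "HOL-Computational_Algebra.Polynomial" "HOL-Combinatorics.List_Permutation"
begin

text \<open>
  Functions on the cycle form the group ring \<open>\<int>[x]/(x\<^sup>n - 1)\<close>, with \<open>x\<close> acting as the rotation. The
  Laplacian of the product is therefore an \<open>m\<close> by \<open>m\<close> matrix over this ring, namely \<open>m + c\<close> times the
  identity minus the all-ones matrix, where \<open>c = 2 - x - 1/x\<close> is the Laplacian of the cycle. Row and column
  operations over the ring split its cokernel into \<open>m - 2\<close> copies of the quotient by \<open>m + c\<close> and one copy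
  of the quotient by \<open>c (m + c)\<close> (\<open>eliminate_complete_graph\<close>, \<open>quot_cyclic_prism\<close>). Up to units,
  \<open>m + c\<close> is \<open>q = x\<^sup>2 - (m + 2) x + 1\<close>, the polynomial with roots \<open>\<alpha>\<close> and \<open>\<beta>\<close>, and \<open>c\<close> is \<open>w\<^sup>2\<close>
  with \<open>w = x - 1\<close>.

  It remains to describe two quotients of \<open>\<int>[x]\<close>, by \<open>(q, x\<^sup>n - 1)\<close> and by \<open>(w\<^sup>2 q, x\<^sup>n - 1)\<close>. In the
  second one the value at \<open>x = 1\<close> gives the free part, and what is left is the quotient by
  \<open>(w q, 1 + x + ... + x\<^sup>n\<^sup>-\<^sup>1)\<close>, where \<open>w q\<close> is monic of degree three. Put \<open>y = x + 1/x - 2\<close>. Modulo \<open>w q\<close> one has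
  \<open>w y = m w\<close> and \<open>y\<^sup>2 = m y\<close>, and the power sums reduce to elements linear in \<open>y\<close> whose coefficients are the
  values of the sequences (\<open>sum_even_powers\<close>): up to a unit, the geometric sum is
  \<open>n - g\<^sub>s y\<close> for \<open>n = 2 s + 1\<close> and \<open>(2 + w) (s - \<tau>\<^sub>s y)\<close> for \<open>n = 2 s\<close>. Modulo \<open>q\<close> alone \<open>y\<close> equals \<open>m\<close>,
  so that \<open>x\<^sup>n - 1\<close> becomes \<open>h\<^sub>s w\<close> or \<open>u\<^sub>s w (w + 2)\<close>.

  The quotients have thus become quotients of \<open>\<int>\<^sup>2\<close> and \<open>\<int>\<^sup>3\<close> by lattices with triangular matrices,
  whose Smith normal forms need only Bezout coefficients (\<open>quot_cyclic_triangular\<close>,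
  \<open>quot_cyclic_triangular3\<close>). The resulting moduli are not yet those of the theorem; the two lists
  differ by replacing pairs \<open>a, b\<close> by their gcd and lcm (\<open>quot_cyclic_gcd_lcm\<close>), once for odd and twice for
  even \<open>n\<close>.
\<close>

section \<open>Finitely generated abelian groups in cyclic coordinates\<close>

text \<open>
  Only the first \<open>length ks\<close> coordinates are constrained. Coordinate vectors are total functions
  on \<open>nat\<close>, so that lists of different lengths share one type.
\<close>

definition diag_lattice :: "int list \<Rightarrow> (nat \<Rightarrow> int) set" where
  "diag_lattice ks = {c. \<forall>j<length ks. ks ! j dvd c j}"

text \<open>
  \<open>\<phi>\<close> induces an isomorphism from the quotient by \<open>I\<close> onto the direct sum of the groups
  \<open>\<int>/k\<close>, \<open>k\<close> in \<open>ks\<close>. It is additive and surjective only modulo \<open>ks\<close>: that is all the quotient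
  sees, and it makes coordinates composable without any choice of representatives.
\<close>

definition coordinates :: "'a::ab_group_add set \<Rightarrow> int list \<Rightarrow> ('a \<Rightarrow> nat \<Rightarrow> int) \<Rightarrow> bool" where
  "coordinates I ks \<phi> \<longleftrightarrow>
     (\<forall>x y. \<phi> (x + y) - (\<phi> x + \<phi> y) \<in> diag_lattice ks) \<and>
     (\<forall>z. \<exists>x. \<phi> x - z \<in> diag_lattice ks) \<and>
     (\<forall>x. x \<in> I \<longleftrightarrow> \<phi> x \<in> diag_lattice ks)"

definition quot_cyclic :: "'a::ab_group_add set \<Rightarrow> int list \<Rightarrow> bool" where
  "quot_cyclic I ks \<longleftrightarrow> (\<exists>\<phi>. coordinates I ks \<phi>)"

definition add_subgroup :: "'a::ab_group_add set \<Rightarrow> bool" where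
  "add_subgroup I \<longleftrightarrow> 0 \<in> I \<and> (\<forall>x\<in>I. \<forall>y\<in>I. x - y \<in> I)"

lemma add_subgroup_uminus: "add_subgroup I \<Longrightarrow> x \<in> I \<Longrightarrow> - x \<in> I"
  unfolding add_subgroup_def by (metis diff_0)

lemma add_subgroup_add: "add_subgroup I \<Longrightarrow> x \<in> I \<Longrightarrow> y \<in> I \<Longrightarrow> x + y \<in> I"
  using add_subgroup_uminus[of I y] unfolding add_subgroup_def
  by (metis diff_minus_eq_add)

lemma add_subgroup_diag_lattice: "add_subgroup (diag_lattice ks)"
  by (auto simp: add_subgroup_def diag_lattice_def)

lemma coordinates_cong:
  assumes "coordinates I ks \<phi>" and "a - b \<in> I"
  shows "\<phi> a - \<phi> b \<in> diag_lattice ks"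
proof -
  have "\<phi> ((a - b) + b) - (\<phi> (a - b) + \<phi> b) \<in> diag_lattice ks" "\<phi> (a - b) \<in> diag_lattice ks"
    using assms unfolding coordinates_def by blast+
  from add_subgroup_add[OF add_subgroup_diag_lattice this]
  show ?thesis by (simp add: algebra_simps)
qed

lemma quot_cyclic_diag: "quot_cyclic (diag_lattice ks) ks"
  unfolding quot_cyclic_def coordinates_def
proof (rule exI[of _ id], intro conjI allI)
  show "\<exists>x. id x - z \<in> diag_lattice ks" for z
    by (rule exI[of _ z]) (simp add: diag_lattice_def)
qed (simp_all add: diag_lattice_def)

text \<open>
  A map that becomes a surjective homomorphism modulo \<open>\<Lambda>\<close> identifies the quotient of its source
  by the preimage of \<open>\<Lambda>\<close> with the quotient of its target by \<open>\<Lambda>\<close>. The summands can therefore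
  be transported step by step, from functions to polynomials to remainders to integer vectors.
\<close>

lemma quot_cyclic_vimage_mod:
  fixes \<theta> :: "'b::ab_group_add \<Rightarrow> 'a::ab_group_add"
  assumes Q: "quot_cyclic \<Lambda> ks" and L: "add_subgroup \<Lambda>"
    and add: "\<And>x y. \<theta> (x + y) - (\<theta> x + \<theta> y) \<in> \<Lambda>"
    and surj: "\<And>z. \<exists>x. \<theta> x - z \<in> \<Lambda>"
  shows "quot_cyclic {y. \<theta> y \<in> \<Lambda>} ks"
proof -
  let ?D = "diag_lattice ks"
  note D = add_subgroup_diag_lattice[of ks]
  obtain \<phi> where co: "coordinates \<Lambda> ks \<phi>"
    using Q unfolding quot_cyclic_def by blast
  then have \<phi>: "\<And>x y. \<phi> (x + y) - (\<phi> x + \<phi> y) \<in> ?D"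
    "\<And>z. \<exists>x. \<phi> x - z \<in> ?D" "\<And>x. x \<in> \<Lambda> \<longleftrightarrow> \<phi> x \<in> ?D"
    unfolding coordinates_def by blast+
  note cong = coordinates_cong[OF co]
  show ?thesis
    unfolding quot_cyclic_def coordinates_def
  proof (intro exI[of _ "\<phi> \<circ> \<theta>"] conjI allI)
    fix x y
    have "(\<phi> (\<theta> (x + y)) - \<phi> (\<theta> x + \<theta> y)) + (\<phi> (\<theta> x + \<theta> y) - (\<phi> (\<theta> x) + \<phi> (\<theta> y))) \<in> ?D"
      by (rule add_subgroup_add[OF D cong[OF add] \<phi>(1)])
    then show "(\<phi> \<circ> \<theta>) (x + y) - ((\<phi> \<circ> \<theta>) x + (\<phi> \<circ> \<theta>) y) \<in> ?D"
      by (simp add: algebra_simps)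
  next
    fix z
    obtain w where w: "\<phi> w - z \<in> ?D" using \<phi>(2) by blast
    obtain x where x: "\<theta> x - w \<in> \<Lambda>" using surj by blast
    have "(\<phi> (\<theta> x) - \<phi> w) + (\<phi> w - z) \<in> ?D"
      by (rule add_subgroup_add[OF D cong[OF x] w])
    then show "\<exists>x. (\<phi> \<circ> \<theta>) x - z \<in> ?D" by (auto simp: algebra_simps)
  next
    fix x show "x \<in> {y. \<theta> y \<in> \<Lambda>} \<longleftrightarrow> (\<phi> \<circ> \<theta>) x \<in> ?D" using \<phi>(3) by simp
  qed
qed

lemma quot_cyclic_vimage:
  fixes \<theta> :: "'b::ab_group_add \<Rightarrow> 'a::ab_group_add"
  assumes "quot_cyclic \<Lambda> ks" and "add_subgroup \<Lambda>"
    and "\<And>x y. \<theta> (x + y) = \<theta> x + \<theta> y"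
    and "\<And>z. \<exists>x. \<theta> x - z \<in> \<Lambda>"
    and "\<And>y. y \<in> I \<longleftrightarrow> \<theta> y \<in> \<Lambda>"
  shows "quot_cyclic I ks"
proof -
  have "quot_cyclic {y. \<theta> y \<in> \<Lambda>} ks"
    using assms(1-4) by (intro quot_cyclic_vimage_mod) (auto simp: add_subgroup_def)
  moreover have "{y. \<theta> y \<in> \<Lambda>} = I" using assms(5) by blast
  ultimately show ?thesis by simp
qed

lemma quot_cyclic_trans:
  assumes "quot_cyclic I ks" and "quot_cyclic (diag_lattice ks) ks'"
  shows "quot_cyclic I ks'"
proof -
  let ?D = "diag_lattice ks"
  obtain \<phi> where \<phi>: "\<And>x y. \<phi> (x + y) - (\<phi> x + \<phi> y) \<in> ?D"
    "\<And>z. \<exists>x. \<phi> x - z \<in> ?D" "\<And>x. x \<in> I \<longleftrightarrow> \<phi> x \<in> ?D"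
    using assms(1) unfolding quot_cyclic_def coordinates_def by blast
  have "quot_cyclic {y. \<phi> y \<in> ?D} ks'"
    using assms(2) add_subgroup_diag_lattice \<phi>(1,2) by (rule quot_cyclic_vimage_mod)
  moreover have "{y. \<phi> y \<in> ?D} = I" using \<phi>(3) by blast
  ultimately show ?thesis by simp
qed

lemma diag_lattice_append:
  "c \<in> diag_lattice (ks @ ls) \<longleftrightarrow>
     c \<in> diag_lattice ks \<and> (\<lambda>j. c (length ks + j)) \<in> diag_lattice ls"
proof -
  have "ls ! j dvd c (length ks + j)"
    if "\<forall>j<length ks + length ls. (ks @ ls) ! j dvd c j" "j < length ls" for j
    using that(1)[rule_format, of "length ks + j"] that(2) by simp
  moreover have "(ks @ ls) ! j dvd c j"
    if "\<forall>j<length ks. ks ! j dvd c j" "\<forall>j<length ls. ls ! j dvd c (length ks + j)"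
      "j < length ks + length ls" for j
    using that(1)[rule_format, of j] that(2)[rule_format, of "j - length ks"] that(3)
    by (auto simp: nth_append)
  moreover have "ks ! j dvd c j"
    if "\<forall>j<length ks + length ls. (ks @ ls) ! j dvd c j" "j < length ks" for j
    using that(1)[rule_format, of j] that(2) by (simp add: nth_append)
  ultimately show ?thesis
    unfolding diag_lattice_def by auto
qed

text \<open>
  Two maps that are jointly surjective modulo \<open>I\<close> and \<open>J\<close> split the quotient into a direct sum;
  this is the Chinese remainder theorem for subgroups.
\<close>

lemma quot_cyclic_join:
  fixes \<theta> :: "'c::ab_group_add \<Rightarrow> 'a::ab_group_add" and \<eta> :: "'c \<Rightarrow> 'b::ab_group_add"
  assumes Q: "quot_cyclic I ks" "quot_cyclic J ls" and IJ: "add_subgroup I" "add_subgroup J"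
    and add: "\<And>x y. \<theta> (x + y) = \<theta> x + \<theta> y" "\<And>x y. \<eta> (x + y) = \<eta> x + \<eta> y"
    and surj: "\<And>a b. \<exists>x. \<theta> x - a \<in> I \<and> \<eta> x - b \<in> J"
    and K: "\<And>x. x \<in> K \<longleftrightarrow> \<theta> x \<in> I \<and> \<eta> x \<in> J"
  shows "quot_cyclic K (ks @ ls)"
proof -
  obtain \<phi> where congI: "coordinates I ks \<phi>"
    using Q(1) unfolding quot_cyclic_def by blast
  then have \<phi>: "\<And>x y. \<phi> (x + y) - (\<phi> x + \<phi> y) \<in> diag_lattice ks"
    "\<And>z. \<exists>x. \<phi> x - z \<in> diag_lattice ks" "\<And>x. x \<in> I \<longleftrightarrow> \<phi> x \<in> diag_lattice ks"
    unfolding coordinates_def by blast+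
  note congI = coordinates_cong[OF congI]
  obtain \<psi> where congJ: "coordinates J ls \<psi>"
    using Q(2) unfolding quot_cyclic_def by blast
  then have \<psi>: "\<And>x y. \<psi> (x + y) - (\<psi> x + \<psi> y) \<in> diag_lattice ls"
    "\<And>z. \<exists>x. \<psi> x - z \<in> diag_lattice ls" "\<And>x. x \<in> J \<longleftrightarrow> \<psi> x \<in> diag_lattice ls"
    unfolding coordinates_def by blast+
  note congJ = coordinates_cong[OF congJ]
  let ?f = "\<lambda>x j. if j < length ks then \<phi> (\<theta> x) j else \<psi> (\<eta> x) (j - length ks)"
  have cong: "c \<in> diag_lattice ks \<longleftrightarrow> d \<in> diag_lattice ks" if "\<And>j. j < length ks \<Longrightarrow> c j = d j"
    for c d
    using that by (simp add: diag_lattice_def)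
  show ?thesis
    unfolding quot_cyclic_def coordinates_def
  proof (intro exI[of _ ?f] conjI allI)
    fix x y
    show "?f (x + y) - (?f x + ?f y) \<in> diag_lattice (ks @ ls)"
      unfolding diag_lattice_append
    proof
      show "?f (x + y) - (?f x + ?f y) \<in> diag_lattice ks"
        using \<phi>(1)[of "\<theta> x" "\<theta> y"] by (subst cong[of _ "\<phi> (\<theta> x + \<theta> y) - (\<phi> (\<theta> x) + \<phi> (\<theta> y))"])
          (simp_all add: add)
      show "(\<lambda>j. (?f (x + y) - (?f x + ?f y)) (length ks + j)) \<in> diag_lattice ls"
        using \<psi>(1)[of "\<eta> x" "\<eta> y"] by (simp add: add fun_diff_def plus_fun_def)
    qed
  next
    fix z
    obtain a where a: "\<phi> a - z \<in> diag_lattice ks" using \<phi>(2) by blast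
    obtain b where b: "\<psi> b - (\<lambda>j. z (length ks + j)) \<in> diag_lattice ls" using \<psi>(2) by blast
    obtain x where x: "\<theta> x - a \<in> I" "\<eta> x - b \<in> J" using surj by blast
    have "\<phi> (\<theta> x) - z \<in> diag_lattice ks"
      using add_subgroup_add[OF add_subgroup_diag_lattice congI[OF x(1)] a] by simp
    then have "?f x - z \<in> diag_lattice ks"
      by (subst cong[of _ "\<phi> (\<theta> x) - z"]) auto
    moreover have "(\<lambda>j. (?f x - z) (length ks + j)) \<in> diag_lattice ls"
      using add_subgroup_add[OF add_subgroup_diag_lattice congJ[OF x(2)] b]
      by (simp add: fun_diff_def plus_fun_def)
    ultimately show "\<exists>x. ?f x - z \<in> diag_lattice (ks @ ls)"
      unfolding diag_lattice_append by blast
  next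
    fix x
    have "?f x \<in> diag_lattice ks \<longleftrightarrow> \<phi> (\<theta> x) \<in> diag_lattice ks"
      by (rule cong) simp
    then show "x \<in> K \<longleftrightarrow> ?f x \<in> diag_lattice (ks @ ls)"
      using K[of x] \<phi>(3)[of "\<theta> x"] \<psi>(3)[of "\<eta> x"] unfolding diag_lattice_append by simp
  qed
qed

lemma quot_cyclic_mset:
  assumes "quot_cyclic I ks" and "mset ks = mset ls"
  shows "quot_cyclic I ls"
proof (rule quot_cyclic_trans[OF assms(1)])
  obtain f where f: "bij_betw f {..<length ls} {..<length ks}" "\<forall>i<length ls. ls ! i = ks ! f i"
    using permutation_Ex_bij[of ls ks] assms(2) by auto
  let ?g = "the_inv_into {..<length ls} f"
  have f_less: "f j < length ks" if "j < length ls" for j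
    using f(1) that by (auto simp: bij_betw_def)
  have g: "?g (f j) = j" if "j < length ls" for j
    using f(1) that by (simp add: bij_betw_def the_inv_into_f_f)
  show "quot_cyclic (diag_lattice ks) ls"
  proof (rule quot_cyclic_vimage[OF quot_cyclic_diag add_subgroup_diag_lattice,
        where \<theta> = "\<lambda>c j. c (f j)"])
    show "\<exists>x. (\<lambda>j. x (f j)) - z \<in> diag_lattice ls" for z :: "nat \<Rightarrow> int"
      by (rule exI[of _ "\<lambda>i. z (?g i)"]) (auto simp: diag_lattice_def g)
    show "c \<in> diag_lattice ks \<longleftrightarrow> (\<lambda>j. c (f j)) \<in> diag_lattice ls" for c
    proof -
      have "(\<forall>i\<in>{..<length ks}. ks ! i dvd c i) \<longleftrightarrow> (\<forall>j\<in>{..<length ls}. ks ! f j dvd c (f j))"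
        unfolding bij_betw_imp_surj_on[OF f(1), symmetric] by blast
      then show ?thesis using f(2) by (simp add: diag_lattice_def Ball_def)
    qed
  qed (simp add: plus_fun_def)
qed

lemma diag_lattice_pair:
  "c \<in> diag_lattice [a, b] \<longleftrightarrow> a dvd c 0 \<and> b dvd c 1"
  by (auto simp: diag_lattice_def less_Suc_eq numeral_2_eq_2)

text \<open>
  The row lattice of the matrix with rows \<open>(a, b)\<close> and \<open>(0, d)\<close>.
\<close>

definition triangular_lattice :: "int \<Rightarrow> int \<Rightarrow> int \<Rightarrow> (int \<times> int) set" where
  "triangular_lattice a b d = {(a * k, b * k + d * l) | k l. True}"

lemma add_subgroup_triangular: "add_subgroup (triangular_lattice a b d)"
  unfolding add_subgroup_def
proof (intro conjI ballI)
  show "0 \<in> triangular_lattice a b d"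
    unfolding triangular_lattice_def zero_prod_def by (auto intro: exI[of _ 0])
  fix x y assume "x \<in> triangular_lattice a b d" "y \<in> triangular_lattice a b d"
  then obtain k l k' l' where "x = (a * k, b * k + d * l)" "y = (a * k', b * k' + d * l')"
    unfolding triangular_lattice_def by blast
  then have "x - y = (a * (k - k'), b * (k - k') + d * (l - l'))"
    by (simp add: algebra_simps)
  then show "x - y \<in> triangular_lattice a b d"
    unfolding triangular_lattice_def by blast
qed

text \<open>
  Bezout coefficients of \<open>a\<close> and \<open>b\<close> give a unimodular column operation taking the first row to
  \<open>(gcd a b, 0)\<close>. The hypothesis \<open>gcd a b dvd d\<close> then lets a row operation clear the first entry of the
  second row, so the Smith normal form is read off without knowing anything else about \<open>d\<close>.
\<close>

lemma quot_cyclic_triangular: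
  assumes a: "a \<noteq> 0" and d: "gcd a b dvd d"
  shows "quot_cyclic (triangular_lattice a b d) [gcd a b, a * d div gcd a b]"
proof -
  define g where "g = gcd a b"
  have g0: "g \<noteq> 0" using a by (simp add: g_def)
  obtain a' b' d' where ab: "a = g * a'" "b = g * b'" "d = g * d'"
    using d unfolding g_def by (meson dvdE gcd_dvd1 gcd_dvd2)
  obtain p r where "p * a + r * b = g" unfolding g_def using bezout_int by blast
  then have "g * (p * a' + r * b') = g * 1" unfolding ab by (simp add: algebra_simps)
  then have pr: "p * a' + r * b' = 1" using g0 mult_left_cancel[of g] by blast
  have a'0: "a' \<noteq> 0" using a ab by auto
  have quo: "a * d div gcd a b = a' * d"
    using g0 unfolding g_def[symmetric] by (simp add: ab(1,3))
  define \<theta> :: "int \<times> int \<Rightarrow> nat \<Rightarrow> int"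
    where "\<theta> = (\<lambda>(x, y) j. if j = 0 then p * x + r * y else a' * y - b' * x)"
  show ?thesis
    unfolding quo unfolding g_def[symmetric]
  proof (rule quot_cyclic_vimage[OF quot_cyclic_diag add_subgroup_diag_lattice, where \<theta> = \<theta>])
    show "\<theta> (x + y) = \<theta> x + \<theta> y" for x y
      by (cases x; cases y) (auto simp: \<theta>_def fun_eq_iff algebra_simps)
    show "\<exists>x. \<theta> x - z \<in> diag_lattice [g, a' * d]" for z
    proof -
      have "p * (a' * z 0 - r * z 1) + r * (b' * z 0 + p * z 1) = (p * a' + r * b') * z 0"
        "a' * (b' * z 0 + p * z 1) - b' * (a' * z 0 - r * z 1) = (p * a' + r * b') * z 1"
        by (simp_all add: algebra_simps)
      then show ?thesis
        by (intro exI[of _ "(a' * z 0 - r * z 1, b' * z 0 + p * z 1)"])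
          (simp add: diag_lattice_pair \<theta>_def pr)
    qed
    show "v \<in> triangular_lattice a b d \<longleftrightarrow> \<theta> v \<in> diag_lattice [g, a' * d]" for v
    proof
      assume "v \<in> triangular_lattice a b d"
      then obtain k l where v: "v = (a * k, b * k + d * l)"
        unfolding triangular_lattice_def by blast
      have "p * (a * k) + r * (b * k + d * l) = g * ((p * a' + r * b') * k + r * d' * l)"
        "a' * (b * k + d * l) - b' * (a * k) = a' * d * l"
        unfolding ab by (simp_all add: algebra_simps)
      then show "\<theta> v \<in> diag_lattice [g, a' * d]"
        unfolding v diag_lattice_pair \<theta>_def by simp
    next
      assume "\<theta> v \<in> diag_lattice [g, a' * d]"
      moreover obtain x y where v: "v = (x, y)" by fastforce
      ultimately obtain s t where s: "p * x + r * y = g * s" and t: "a' * y - b' * x = a' * d * t"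
        unfolding diag_lattice_pair \<theta>_def by (auto elim!: dvdE)
      \<comment> \<open>Invert the unimodular matrix with rows \<open>(p, r)\<close> and \<open>(-b', a')\<close>.\<close>
      have "x = a' * (p * x + r * y) - r * (a' * y - b' * x)
            + (1 - (p * a' + r * b')) * x" by (simp add: algebra_simps)
      then have x: "x = a * (s - r * d' * t)"
        unfolding s t pr unfolding ab by (simp add: algebra_simps)
      have "y = b' * (p * x + r * y) + p * (a' * y - b' * x)
            + (1 - (p * a' + r * b')) * y" by (simp add: algebra_simps)
      then have "y = b * s + p * a' * d * t"
        unfolding s t pr unfolding ab by (simp add: algebra_simps)
      also have "p * a' = 1 - r * b'" using pr by simp
      finally have y: "y = b * (s - r * d' * t) + d * t"
        unfolding ab by (simp add: algebra_simps)
      show "v \<in> triangular_lattice a b d"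
        unfolding triangular_lattice_def v using x y by blast
    qed
  qed
qed

lemma quot_cyclic_int: "quot_cyclic {x::int. k dvd x} [k]"
  unfolding quot_cyclic_def coordinates_def
proof (rule exI[of _ "\<lambda>x _. x"], intro conjI allI)
  show "\<exists>x. (\<lambda>_. x) - z \<in> diag_lattice [k]" for z :: "nat \<Rightarrow> int"
    by (rule exI[of _ "z 0"]) (simp add: diag_lattice_def)
qed (simp_all add: diag_lattice_def)

lemma add_subgroup_multiples: "add_subgroup {x::int. k dvd x}"
  by (simp add: add_subgroup_def)

text \<open>
  The diagonal matrix with entries \<open>a\<close> and \<open>b\<close> has the same row lattice as the triangular one with
  rows \<open>(a, b)\<close> and \<open>(0, b)\<close>, to which \<open>quot_cyclic_triangular\<close> applies.
\<close>

lemma quot_cyclic_gcd_lcm: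
  assumes "quot_cyclic I (a # b # ks)" and "a \<noteq> 0"
  shows "quot_cyclic I (gcd a b # (a * b div gcd a b) # ks)"
proof (rule quot_cyclic_trans[OF assms(1)])
  have "quot_cyclic (diag_lattice (a # b # ks)) ([gcd a b, a * b div gcd a b] @ ks)"
  proof (rule quot_cyclic_join[OF quot_cyclic_triangular[OF assms(2)] quot_cyclic_diag
        add_subgroup_triangular add_subgroup_diag_lattice,
        where \<theta> = "\<lambda>c. (c 0, c 1)" and \<eta> = "\<lambda>c j. c (j + 2)"])
    show "gcd a b dvd b" by simp
    show "\<exists>x. (x 0, x 1) - z \<in> triangular_lattice a b b \<and> (\<lambda>j. x (j + 2)) - w \<in> diag_lattice ks"
      for z :: "int \<times> int" and w
    proof (rule exI[of _ "\<lambda>j. if j = 0 then fst z else if j = 1 then snd z else w (j - 2)"])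
      show "((if (0::nat) = 0 then fst z else if 0 = (1::nat) then snd z else w (0 - 2)),
             (if (1::nat) = 0 then fst z else if 1 = (1::nat) then snd z else w (1 - 2))) - z
              \<in> triangular_lattice a b b \<and>
            (\<lambda>j. if j + 2 = 0 then fst z else if j + 2 = 1 then snd z else w (j + 2 - 2)) - w
              \<in> diag_lattice ks"
        using add_subgroup_triangular[of a b b] add_subgroup_diag_lattice[of ks]
        by (simp add: add_subgroup_def)
    qed
    show "c \<in> diag_lattice (a # b # ks) \<longleftrightarrow>
        (c 0, c 1) \<in> triangular_lattice a b b \<and> (\<lambda>j. c (j + 2)) \<in> diag_lattice ks" for c
    proof -
      have "(c 0, c 1) \<in> triangular_lattice a b b \<longleftrightarrow> c \<in> diag_lattice [a, b]"
        unfolding diag_lattice_pair triangular_lattice_def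
      proof safe
        fix k l assume "a dvd c 0" "b dvd c 1"
        then obtain k l where "c 0 = a * k" "c 1 = b * l" by (auto elim!: dvdE)
        then show "\<exists>k l. (c 0, c 1) = (a * k, b * k + b * l) \<and> True"
          by (intro exI[of _ k] exI[of _ "l - k"]) (simp add: algebra_simps)
      qed auto
      then show ?thesis
        using diag_lattice_append[of c "[a, b]" ks] by (simp add: add.commute)
    qed
  qed (auto simp: plus_fun_def)
  then show "quot_cyclic (diag_lattice (a # b # ks)) (gcd a b # (a * b div gcd a b) # ks)" by simp
qed

section \<open>From cyclic coordinates to the critical group\<close>

lemma group_cyclic_sum: "group (cyclic_sum ks)"
  by (simp add: cyclic_sum_def)

lemma carrier_cyclic_sum:
  "carrier (cyclic_sum ks) =
     (\<Pi>\<^sub>E j\<in>{..<length ks}. carrier (integer_mod_group (nat \<bar>ks ! j\<bar>)))"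
  by (auto simp: cyclic_sum_def carrier_sum_group)

lemma one_cyclic_sum: "\<one>\<^bsub>cyclic_sum ks\<^esub> = (\<lambda>j\<in>{..<length ks}. 0)"
  by (simp add: cyclic_sum_def)

lemma mult_cyclic_sum:
  "x \<otimes>\<^bsub>cyclic_sum ks\<^esub> y = (\<lambda>j\<in>{..<length ks}. (x j + y j) mod \<bar>ks ! j\<bar>)"
  by (simp add: cyclic_sum_def)

lemma pow_cyclic_sum:
  assumes "c \<in> carrier (cyclic_sum ks)"
  shows "c [^]\<^bsub>cyclic_sum ks\<^esub> k = (\<lambda>j\<in>{..<length ks}. (int k * c j) mod \<bar>ks ! j\<bar>)"
proof (induction k)
  case 0
  then show ?case by (simp add: one_cyclic_sum cong: restrict_cong)
next
  case (Suc k)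
  then show ?case
    by (simp add: mult_cyclic_sum mod_add_right_eq algebra_simps cong: restrict_cong)
qed

lemma mod_mem_integer_mod_group: "x mod \<bar>k\<bar> \<in> carrier (integer_mod_group (nat \<bar>k\<bar>))"
  by (simp add: carrier_integer_mod_group)

lemma mod_integer_mod_group:
  "x \<in> carrier (integer_mod_group (nat \<bar>k\<bar>)) \<Longrightarrow> x mod \<bar>k\<bar> = x"
  by (auto simp: carrier_integer_mod_group split: if_splits)

text \<open>
  The image of the Laplacian, with functions on the whole vertex type instead of extensional ones:
  values outside the vertex set are arbitrary. This makes the ambient group a type.
\<close>

definition laplacian_lattice :: "('a, 'b) pre_digraph \<Rightarrow> ('a \<Rightarrow> int) set" where
  "laplacian_lattice G =
     {f. \<exists>g. \<forall>u\<in>verts G. f u = (\<Sum>v\<in>verts G. laplacian G u v * g v)}"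

text \<open>
  The first isomorphism theorem for the coordinate map reduced modulo \<open>ks\<close>.
\<close>

lemma laplacian_cokernel_iso:
  assumes "quot_cyclic (laplacian_lattice G) ks"
  shows "group (laplacian_cokernel G)" and "laplacian_cokernel G \<cong> cyclic_sum ks"
proof -
  let ?V = "verts G" and ?N = "{..<length ks}" and ?D = "diag_lattice ks"
  obtain \<phi> where co: "coordinates (laplacian_lattice G) ks \<phi>"
    using assms unfolding quot_cyclic_def by blast
  then have \<phi>: "\<And>x y. \<phi> (x + y) - (\<phi> x + \<phi> y) \<in> ?D"
    "\<And>z. \<exists>x. \<phi> x - z \<in> ?D" "\<And>x. x \<in> laplacian_lattice G \<longleftrightarrow> \<phi> x \<in> ?D"
    unfolding coordinates_def by blast+
  have agree: "\<phi> x - \<phi> y \<in> ?D" if "\<And>u. u \<in> ?V \<Longrightarrow> x u = y u" for x y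
    using that by (intro coordinates_cong[OF co])
      (auto simp: laplacian_lattice_def intro!: exI[of _ "\<lambda>_. 0"])
  define h where "h x = (\<lambda>j\<in>?N. \<phi> x j mod \<bar>ks ! j\<bar>)" for x
  have h_eq: "h x = (\<lambda>j\<in>?N. z j mod \<bar>ks ! j\<bar>)" if "\<phi> x - z \<in> ?D" for x z
    using that unfolding h_def
    by (intro restrict_ext) (auto simp: diag_lattice_def mod_eq_dvd_iff)
  let ?Z = "vertex_lattice G"
  have Z: "group ?Z" "carrier ?Z = (\<Pi>\<^sub>E v\<in>?V. UNIV)"
    "\<And>x y. x \<otimes>\<^bsub>?Z\<^esub> y = (\<lambda>v\<in>?V. x v + y v)"
    by (simp_all add: vertex_lattice_def)
  have hom: "group_hom ?Z (cyclic_sum ks) h"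
  proof (rule group_hom.intro[OF Z(1) group_cyclic_sum], unfold_locales, rule homI)
    show "h x \<in> carrier (cyclic_sum ks)" for x
      by (auto simp: h_def carrier_cyclic_sum mod_mem_integer_mod_group)
    show "h (x \<otimes>\<^bsub>?Z\<^esub> y) = h x \<otimes>\<^bsub>cyclic_sum ks\<^esub> h y" for x y
    proof -
      have "(\<phi> (\<lambda>v\<in>?V. x v + y v) - \<phi> (x + y)) + (\<phi> (x + y) - (\<phi> x + \<phi> y)) \<in> ?D"
        by (rule add_subgroup_add[OF add_subgroup_diag_lattice agree \<phi>(1)]) auto
      then have "\<phi> (\<lambda>v\<in>?V. x v + y v) - (\<phi> x + \<phi> y) \<in> ?D"
        by (simp add: algebra_simps del: minus_apply plus_fun_apply)
      then have "h (\<lambda>v\<in>?V. x v + y v) = (\<lambda>j\<in>?N. (\<phi> x + \<phi> y) j mod \<bar>ks ! j\<bar>)"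
        by (rule h_eq)
      then show ?thesis
        by (simp add: Z mult_cyclic_sum h_def mod_add_eq cong: restrict_cong)
    qed
  qed
  have surj: "h ` carrier ?Z = carrier (cyclic_sum ks)"
  proof
    show "h ` carrier ?Z \<subseteq> carrier (cyclic_sum ks)"
      using group_hom.hom_closed[OF hom] by blast
    show "carrier (cyclic_sum ks) \<subseteq> h ` carrier ?Z"
    proof
      fix c assume c: "c \<in> carrier (cyclic_sum ks)"
      obtain x where x: "\<phi> x - c \<in> ?D" using \<phi>(2) by blast
      have "(\<phi> (restrict x ?V) - \<phi> x) + (\<phi> x - c) \<in> ?D"
        by (rule add_subgroup_add[OF add_subgroup_diag_lattice agree x]) auto
      then have "h (restrict x ?V) = (\<lambda>j\<in>?N. c j mod \<bar>ks ! j\<bar>)"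
        by (intro h_eq) simp
      also have "\<dots> = c"
        using c by (auto simp: carrier_cyclic_sum PiE_iff extensional_def mod_integer_mod_group)
      finally show "c \<in> h ` carrier ?Z"
        by (intro image_eqI[of _ _ "restrict x ?V"]) (auto simp: Z)
    qed
  qed
  have ker: "kernel ?Z (cyclic_sum ks) h = laplacian_image G"
  proof -
    have one: "h x = \<one>\<^bsub>cyclic_sum ks\<^esub> \<longleftrightarrow> x \<in> laplacian_lattice G" for x
      unfolding \<phi>(3) h_def one_cyclic_sum diag_lattice_def
      by (auto simp: fun_eq_iff restrict_def mod_eq_0_iff_dvd split: if_splits)
    have "x \<in> laplacian_image G \<longleftrightarrow> x \<in> carrier ?Z \<and> x \<in> laplacian_lattice G" for x
    proof
      assume "x \<in> laplacian_image G"
      then show "x \<in> carrier ?Z \<and> x \<in> laplacian_lattice G"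
        unfolding laplacian_image_def laplacian_lattice_def by (auto simp: Z)
    next
      assume x: "x \<in> carrier ?Z \<and> x \<in> laplacian_lattice G"
      then obtain g where g: "\<And>u. u \<in> ?V \<Longrightarrow> x u = (\<Sum>v\<in>?V. laplacian G u v * g v)"
        unfolding laplacian_lattice_def by blast
      have "x = (\<lambda>u\<in>?V. \<Sum>v\<in>?V. laplacian G u v * restrict g ?V v)"
        using x g by (auto simp: Z fun_eq_iff PiE_iff extensional_def)
      then show "x \<in> laplacian_image G"
        unfolding laplacian_image_def
        by (intro image_eqI[of _ _ "restrict g ?V"]) (auto simp: Z)
    qed
    then show ?thesis unfolding kernel_def by (auto simp: one)
  qed
  have "laplacian_image G \<lhd> ?Z"
    using group_hom.normal_kernel[OF hom] ker by simp
  then show "group (laplacian_cokernel G)"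
    unfolding laplacian_cokernel_def by (rule normal.factorgroup_is_group)
  show "laplacian_cokernel G \<cong> cyclic_sum ks"
    unfolding laplacian_cokernel_def using group_hom.FactGroup_iso[OF hom surj] ker by simp
qed

lemma torsion_subgroup_cong:
  assumes "group A" "group B" "A \<cong> B"
  shows "torsion_subgroup A \<cong> torsion_subgroup B"
proof -
  obtain f where f: "f \<in> iso A B" using assms(3) unfolding is_iso_def by blast
  then have hom: "group_hom A B f"
    using assms(1,2) by (simp add: group_hom_def group_hom_axioms_def iso_def)
  have bij: "bij_betw f (carrier A) (carrier B)" using f by (simp add: iso_def)
  have f1: "f x = \<one>\<^bsub>B\<^esub> \<longleftrightarrow> x = \<one>\<^bsub>A\<^esub>" if "x \<in> carrier A" for x
    using bij that group_hom.hom_one[OF hom] group.is_monoid[OF assms(1)]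
    by (metis bij_betw_def inj_onD monoid.one_closed)
  have pow: "f x [^]\<^bsub>B\<^esub> k = \<one>\<^bsub>B\<^esub> \<longleftrightarrow> x [^]\<^bsub>A\<^esub> k = \<one>\<^bsub>A\<^esub>"
    if "x \<in> carrier A" for x and k :: nat
    using f1[of "x [^]\<^bsub>A\<^esub> k"] that group_hom.hom_nat_pow[OF hom that, of k]
      monoid.nat_pow_closed[OF group.is_monoid[OF assms(1)] that, of k] by simp
  have "f \<in> iso (torsion_subgroup A) (torsion_subgroup B)"
  proof (rule isoI)
    show "f \<in> hom (torsion_subgroup A) (torsion_subgroup B)"
      using f pow by (auto simp: torsion_subgroup_def hom_def iso_def Pi_iff)
    show "bij_betw f (carrier (torsion_subgroup A)) (carrier (torsion_subgroup B))"
      unfolding bij_betw_def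
    proof
      show "inj_on f (carrier (torsion_subgroup A))"
        using bij by (auto simp: torsion_subgroup_def bij_betw_def inj_on_def)
      show "f ` carrier (torsion_subgroup A) = carrier (torsion_subgroup B)"
        using bij pow unfolding bij_betw_def torsion_subgroup_def
        by (auto simp: image_iff) (metis imageE)+
    qed
  qed
  then show ?thesis unfolding is_iso_def by blast
qed

text \<open>
  A modulus 0 contributes a copy of \<open>\<int>\<close>, while the remaining summands are finite. An element is
  therefore torsion exactly when its first coordinate vanishes.
\<close>

lemma torsion_subgroup_cyclic_sum:
  assumes "0 \<notin> set ks"
  shows "torsion_subgroup (cyclic_sum (0 # ks)) \<cong> cyclic_sum ks"
proof -
  let ?C = "cyclic_sum (0 # ks)" and ?N = "{..<length ks}"
  have carrier: "c \<in> carrier (torsion_subgroup ?C) \<longleftrightarrow> c \<in> carrier ?C \<and> c 0 = 0" for c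
  proof (cases "c \<in> carrier ?C")
    case True
    \<comment> \<open>The product of the moduli annihilates every element whose first coordinate is zero.\<close>
    define K where "K = nat \<bar>prod_list ks\<bar>"
    have "c [^]\<^bsub>?C\<^esub> K = \<one>\<^bsub>?C\<^esub>" if "c 0 = 0"
      unfolding pow_cyclic_sum[OF True] one_cyclic_sum
    proof (rule restrict_ext)
      fix j assume j: "j \<in> {..<length (0 # ks)}"
      show "int K * c j mod \<bar>(0 # ks) ! j\<bar> = 0"
      proof (cases j)
        case (Suc i)
        then have "ks ! i dvd prod_list ks" using j by (intro prod_list_dvd) auto
        then show ?thesis using Suc by (simp add: mod_eq_0_iff_dvd K_def)
      qed (simp add: that)
    qed
    moreover have "K > 0" using assms by (simp add: K_def prod_list_zero_iff)
    moreover have "c 0 = 0" if "c [^]\<^bsub>?C\<^esub> k = \<one>\<^bsub>?C\<^esub>" "k > 0" for k :: nat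
      using fun_cong[OF that(1), of 0] that(2)
      unfolding pow_cyclic_sum[OF True] one_cyclic_sum by simp
    ultimately show ?thesis
      using True unfolding torsion_subgroup_def by auto
  qed (simp add: torsion_subgroup_def)
  let ?h = "\<lambda>c. \<lambda>j\<in>?N. c (Suc j)"
  have C: "c \<in> carrier ?C \<longleftrightarrow> c \<in> extensional {..<Suc (length ks)} \<and>
      (\<forall>j<length ks. c (Suc j) \<in> carrier (integer_mod_group (nat \<bar>ks ! j\<bar>)))" for c
  proof -
    have "(\<forall>j<Suc (length ks). c j \<in> carrier (integer_mod_group (nat \<bar>(0 # ks) ! j\<bar>))) \<longleftrightarrow>
        (\<forall>j<length ks. c (Suc j) \<in> carrier (integer_mod_group (nat \<bar>ks ! j\<bar>)))"
      by (simp add: All_less_Suc2 carrier_integer_mod_group)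
    then show ?thesis
      by (auto simp: carrier_cyclic_sum PiE_iff Ball_def)
  qed
  have "?h \<in> iso (torsion_subgroup ?C) (cyclic_sum ks)"
  proof (rule isoI)
    show "?h \<in> hom (torsion_subgroup ?C) (cyclic_sum ks)"
    proof (rule homI)
      fix x assume "x \<in> carrier (torsion_subgroup ?C)"
      then show "?h x \<in> carrier (cyclic_sum ks)"
        unfolding carrier C by (auto simp: carrier_cyclic_sum)
    qed (simp add: torsion_subgroup_def mult_cyclic_sum cong: restrict_cong)
    show "bij_betw ?h (carrier (torsion_subgroup ?C)) (carrier (cyclic_sum ks))"
    proof (rule bij_betwI[where g = "\<lambda>c. \<lambda>j\<in>{..<Suc (length ks)}. if j = 0 then 0 else c (j - 1)"])
      show "?h \<in> carrier (torsion_subgroup ?C) \<rightarrow> carrier (cyclic_sum ks)"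
        by (rule funcsetI, unfold carrier C) (auto simp: carrier_cyclic_sum)
      show "(\<lambda>c. \<lambda>j\<in>{..<Suc (length ks)}. if j = 0 then 0 else c (j - 1))
          \<in> carrier (cyclic_sum ks) \<rightarrow> carrier (torsion_subgroup ?C)"
        unfolding Pi_iff carrier C by (auto simp: carrier_cyclic_sum)
      show "(\<lambda>j\<in>{..<Suc (length ks)}. if j = 0 then 0 else ?h x (j - 1)) = x"
        if "x \<in> carrier (torsion_subgroup ?C)" for x
        using that unfolding carrier C by (auto simp: fun_eq_iff extensional_def)
      show "?h (\<lambda>j\<in>{..<Suc (length ks)}. if j = 0 then 0 else y (j - 1)) = y"
        if "y \<in> carrier (cyclic_sum ks)" for y
        using that by (auto simp: fun_eq_iff carrier_cyclic_sum PiE_iff extensional_def)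
    qed
  qed
  then show ?thesis unfolding is_iso_def by blast
qed

lemma critical_group_iso:
  assumes "quot_cyclic (laplacian_lattice G) (0 # ks)" and "0 \<notin> set ks"
  shows "critical_group G \<cong> cyclic_sum ks"
proof -
  have "critical_group G \<cong> torsion_subgroup (cyclic_sum (0 # ks))"
    unfolding critical_group_def
    by (rule torsion_subgroup_cong[OF laplacian_cokernel_iso(1)[OF assms(1)] group_cyclic_sum
          laplacian_cokernel_iso(2)[OF assms(1)]])
  then show ?thesis
    using torsion_subgroup_cyclic_sum[OF assms(2)] by (rule iso_trans)
qed

section \<open>Eliminating the complete graph over a commutative ring\<close>

definition ideal2 :: "'a::comm_ring_1 \<Rightarrow> 'a \<Rightarrow> 'a set" where
  "ideal2 a b = {a * k + b * l | k l. True}"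

lemma ideal2I: "x = a * k + b * l \<Longrightarrow> x \<in> ideal2 a b"
  unfolding ideal2_def by blast

lemma ideal2E:
  assumes "x \<in> ideal2 a b" obtains k l where "x = a * k + b * l"
  using assms unfolding ideal2_def by blast

lemma ideal2_right: "b dvd x \<Longrightarrow> x \<in> ideal2 a b"
  by (erule dvdE, rule ideal2I[of _ _ 0]) simp

lemma add_subgroup_ideal2: "add_subgroup (ideal2 a b)"
  unfolding add_subgroup_def
proof (intro conjI ballI)
  show "0 \<in> ideal2 a b" by (rule ideal2I[of _ _ 0 _ 0]) simp
  fix x y assume "x \<in> ideal2 a b" "y \<in> ideal2 a b"
  then obtain k l k' l' where "x = a * k + b * l" "y = a * k' + b * l'"
    by (auto elim!: ideal2E)
  then show "x - y \<in> ideal2 a b"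
    by (intro ideal2I[of _ _ "k - k'" _ "l - l'"]) (simp add: algebra_simps)
qed

lemma sum_lessThan_split_two:
  fixes F :: "nat \<Rightarrow> 'a::comm_monoid_add"
  assumes "m \<ge> 2"
  shows "(\<Sum>a<m. F a) = F 0 + (F 1 + (\<Sum>a\<in>{2..<m}. F a))"
proof -
  have "{..<m} = insert 0 (insert 1 {2..<m})" using assms by auto
  then show ?thesis by simp
qed

text \<open>
  Here \<open>x\<close> stands for the rotation of the cycle, a unit modulo \<open>E = x\<^sup>n - 1\<close>, and \<open>P a\<close>, \<open>g a\<close> for the
  part of a function that lives on the copy of the cycle over the vertex \<open>a\<close> of the complete graph.
  After multiplication by \<open>- x\<close> the Laplacian sends \<open>g\<close> to \<open>q * g a + x * (\<Sum>b. g b)\<close>. Subtracting the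
  equation for \<open>a = 1\<close> removes the sum, and adding all equations turns \<open>q\<close> into
  \<open>q + m x = (x - 1)\<^sup>2\<close>. So the cokernel splits into \<open>m - 2\<close> quotients by \<open>q\<close> and one quotient by
  \<open>(x - 1)\<^sup>2 q\<close>. For the converse, \<open>g\<close> is reconstructed from the prescribed quotients, \<open>G\<close> being its
  sum over the complete graph.
\<close>

lemma eliminate_complete_graph:
  fixes x x' w q E :: "'a::comm_ring_1" and P :: "nat \<Rightarrow> 'a"
  assumes m: "m \<ge> 2" and inv: "x * x' = 1 + E"
    and w: "w = x - 1" and q: "q = w\<^sup>2 - of_nat m * x"
  shows "(\<exists>g. \<forall>a<m. E dvd x * P a + q * g a + x * (\<Sum>b<m. g b)) \<longleftrightarrow>
     (\<forall>a\<in>{2..<m}. P a - P 1 \<in> ideal2 q E) \<and>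
     x * (\<Sum>a<m. P a) - w\<^sup>2 * P 1 \<in> ideal2 (w\<^sup>2 * q) E"
proof
  assume "\<exists>g. \<forall>a<m. E dvd x * P a + q * g a + x * (\<Sum>b<m. g b)"
  then obtain g e where e: "\<And>a. a < m \<Longrightarrow> x * P a + q * g a + x * (\<Sum>b<m. g b) = E * e a"
    unfolding dvd_def by metis
  have divide: "p = b * (x' * k) + E * (x' * l - p)" if "x * p = b * k + E * l" for p b k l
  proof -
    have "x' * (x * p) = (x * x') * p" by (simp only: ac_simps)
    then have "x' * (x * p) = p + E * p" unfolding inv by (simp only: distrib_right mult_1_left)
    then show ?thesis unfolding that by (simp add: algebra_simps)
  qed
  have "P a - P 1 \<in> ideal2 q E" if a: "a \<in> {2..<m}" for a
  proof (rule ideal2I[OF divide])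
    show "x * (P a - P 1) = q * (g 1 - g a) + E * (e a - e 1)"
    proof -
      have *: "x * P a = E * e a - q * g a - x * (\<Sum>b<m. g b)"
        "x * P 1 = E * e 1 - q * g 1 - x * (\<Sum>b<m. g b)"
        using e[of a, symmetric] e[of 1, symmetric] a m by simp_all
      show ?thesis unfolding right_diff_distrib[of x] * by (simp add: algebra_simps)
    qed
  qed
  moreover have "x * (\<Sum>a<m. P a) - w\<^sup>2 * P 1 \<in> ideal2 (w\<^sup>2 * q) E"
  proof (rule ideal2I[OF divide])
    let ?G = "\<Sum>b<m. g b"
    have "(\<Sum>a<m. x * P a + q * g a + x * ?G) = E * (\<Sum>a<m. e a)"
      using e by (simp add: sum_distrib_left)
    then have "x * (\<Sum>a<m. P a) + w\<^sup>2 * ?G = E * (\<Sum>a<m. e a)"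
      by (simp add: sum.distrib sum_subtractf sum_distrib_left sum_distrib_right q algebra_simps)
    then have "x * (\<Sum>a<m. P a) = E * (\<Sum>a<m. e a) - w\<^sup>2 * ?G" by (simp add: algebra_simps)
    moreover have "x * P 1 = E * e 1 - q * g 1 - x * ?G" using e[of 1] m by (simp add: algebra_simps)
    ultimately have "x * (x * (\<Sum>a<m. P a)) - w\<^sup>2 * (x * P 1)
        = x * (E * (\<Sum>a<m. e a) - w\<^sup>2 * ?G) - w\<^sup>2 * (E * e 1 - q * g 1 - x * ?G)" by simp
    then show "x * (x * (\<Sum>a<m. P a) - w\<^sup>2 * P 1)
        = w\<^sup>2 * q * g 1 + E * (x * (\<Sum>a<m. e a) - w\<^sup>2 * e 1)"
      by (simp add: algebra_simps)
  qed
  ultimately show "(\<forall>a\<in>{2..<m}. P a - P 1 \<in> ideal2 q E) \<and>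
     x * (\<Sum>a<m. P a) - w\<^sup>2 * P 1 \<in> ideal2 (w\<^sup>2 * q) E" by blast
next
  assume A: "(\<forall>a\<in>{2..<m}. P a - P 1 \<in> ideal2 q E) \<and>
     x * (\<Sum>a<m. P a) - w\<^sup>2 * P 1 \<in> ideal2 (w\<^sup>2 * q) E"
  then have "\<forall>a\<in>{2..<m}. \<exists>k e. P a - P 1 = q * k + E * e" unfolding ideal2_def by blast
  then obtain k e where ke: "\<And>a. a \<in> {2..<m} \<Longrightarrow> P a - P 1 = q * k a + E * e a" by metis
  obtain k' e' where ke': "x * (\<Sum>a<m. P a) - w\<^sup>2 * P 1 = w\<^sup>2 * q * k' + E * e'"
    using A by (auto elim: ideal2E)
  \<comment> \<open>This choice makes the equation for \<open>a = 1\<close> hold exactly, with \<open>g 1 = x * k'\<close>.\<close>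
  define G where "G = - (P 1 + q * k')"
  define g where "g a = (if a = 0 then G - x * k' - (\<Sum>b\<in>{2..<m}. x * k' - x * k b)
      else if a = 1 then x * k' else x * k' - x * k a)" for a :: nat
  have G: "(\<Sum>b<m. g b) = G"
    unfolding sum_lessThan_split_two[OF m] by (simp add: g_def)
  let ?r = "\<lambda>a. x * P a + q * g a + x * G"
  have r1: "?r 1 = 0" by (simp add: g_def G_def algebra_simps)
  have r2: "?r a = E * (x * e a)" if "a \<in> {2..<m}" for a
  proof -
    have "?r a = x * (P a - P 1) - x * (q * k a)"
      using that by (simp add: g_def G_def algebra_simps)
    then show ?thesis unfolding ke[OF that] by (simp add: algebra_simps)
  qed
  have "(\<Sum>a<m. ?r a) = x * (\<Sum>a<m. P a) + q * (\<Sum>a<m. g a) + of_nat m * x * G"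
    by (simp add: sum.distrib sum_distrib_left[symmetric] algebra_simps)
  also have "\<dots> = (x * (\<Sum>a<m. P a) - w\<^sup>2 * P 1) - w\<^sup>2 * q * k'"
    unfolding G by (simp add: q G_def algebra_simps)
  also have "\<dots> = E * e'" unfolding ke' by simp
  finally have "?r 0 = E * e' - (\<Sum>a\<in>{2..<m}. E * (x * e a))"
    unfolding sum_lessThan_split_two[OF m] r1 using r2 by (simp add: algebra_simps)
  then have r0: "?r 0 = E * (e' - (\<Sum>a\<in>{2..<m}. x * e a))"
    by (simp add: sum_distrib_left right_diff_distrib)
  have "E dvd ?r a" if "a < m" for a
  proof -
    have "a = 0 \<or> a = 1 \<or> a \<in> {2..<m}" using that by auto
    then show ?thesis using r0 r1 r2 by fastforce
  qed
  then show "\<exists>g. \<forall>a<m. E dvd x * P a + q * g a + x * (\<Sum>b<m. g b)"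
    using G by (intro exI[of _ g]) simp
qed

section \<open>Functions on the cycle as polynomials\<close>

text \<open>
  Functions on the cycle form the group ring \<open>\<int>[x]/(x\<^sup>n - 1)\<close>. The polynomial variable is
  \<open>w = x - 1\<close> rather than \<open>x\<close>, that is \<open>x = [:1, 1:]\<close>, because the ideals met below have
  simple generators and reductions in powers of \<open>w\<close>.
\<close>

definition cyc_poly :: "nat \<Rightarrow> (nat \<Rightarrow> int) \<Rightarrow> int poly" where
  "cyc_poly n f = (\<Sum>i<n. of_int (f i) * [:1, 1:] ^ i)"

definition cyc_mod :: "nat \<Rightarrow> int poly" where
  "cyc_mod n = [:1, 1:] ^ n - 1"

lemma cyc_poly_add: "cyc_poly n (\<lambda>i. f i + g i) = cyc_poly n f + cyc_poly n g"
  by (simp add: cyc_poly_def sum.distrib algebra_simps)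

lemma cyc_poly_diff: "cyc_poly n (\<lambda>i. f i - g i) = cyc_poly n f - cyc_poly n g"
  by (simp add: cyc_poly_def sum_subtractf algebra_simps)

lemma cyc_poly_scale: "cyc_poly n (\<lambda>i. c * f i) = of_int c * cyc_poly n f"
  by (simp add: cyc_poly_def sum_distrib_left algebra_simps)

lemma cyc_poly_sum: "cyc_poly n (\<lambda>i. \<Sum>b\<in>B. f b i) = (\<Sum>b\<in>B. cyc_poly n (f b))"
  unfolding cyc_poly_def by (subst sum.swap) (simp add: sum_distrib_right)

lemma cyc_poly_cong: "(\<And>i. i < n \<Longrightarrow> f i = g i) \<Longrightarrow> cyc_poly n f = cyc_poly n g"
  unfolding cyc_poly_def by (intro sum.cong) auto

lemma cyc_poly_next:
  assumes "n > 0"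
  shows "[:1, 1:] * cyc_poly n (\<lambda>i. f (Suc i mod n)) = cyc_poly n f + of_int (f 0) * cyc_mod n"
proof -
  obtain k where k: "n = Suc k" using assms by (cases n) auto
  define x :: "int poly" where "x = [:1, 1:]"
  have "x * (\<Sum>i<n. of_int (f (Suc i mod n)) * x ^ i) = (\<Sum>i<n. of_int (f (Suc i mod n)) * x ^ Suc i)"
    unfolding sum_distrib_left by (intro sum.cong) (simp_all only: power_Suc ac_simps)
  also have "\<dots> = (\<Sum>i<k. of_int (f (Suc i)) * x ^ Suc i) + of_int (f 0) * x ^ n"
    unfolding k sum.lessThan_Suc by simp
  also have "(\<Sum>i<k. of_int (f (Suc i)) * x ^ Suc i) = (\<Sum>i<n. of_int (f i) * x ^ i) - of_int (f 0)"
    unfolding k sum.lessThan_Suc_shift by simp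
  finally show ?thesis
    unfolding cyc_mod_def cyc_poly_def x_def[symmetric] by (simp add: algebra_simps)
qed

lemma cyc_poly_prev:
  assumes "n > 0"
  shows "cyc_mod n dvd [:1, 1:] * cyc_poly n f - cyc_poly n (\<lambda>i. f ((i + n - 1) mod n))"
proof -
  let ?p = "\<lambda>i. f ((i + n - 1) mod n)"
  have "cyc_poly n (\<lambda>i. ?p (Suc i mod n)) = cyc_poly n f"
  proof (rule cyc_poly_cong)
    fix i assume i: "i < n"
    have "(Suc i mod n + n - 1) mod n = i"
    proof (cases "Suc i = n")
      case True
      then show ?thesis using i by auto
    next
      case False
      then show ?thesis using i by simp
    qed
    then show "?p (Suc i mod n) = f i" by simp
  qed
  then show ?thesis using cyc_poly_next[OF assms, of ?p] by simp
qed

text \<open>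
  Polynomials of this form are closed, modulo \<open>x\<^sup>n - 1\<close>, under multiplication by \<open>x\<close>, hence by
  \<open>w = x - 1\<close>; so Horner's scheme reaches every polynomial.
\<close>

lemma cyc_poly_surj:
  assumes "n > 0"
  shows "\<exists>f. cyc_mod n dvd p - cyc_poly n f"
proof (induction p)
  case 0
  have "cyc_poly n (\<lambda>_. 0) = 0" by (simp add: cyc_poly_def)
  then show ?case by (intro exI[of _ "\<lambda>_. 0"]) simp
next
  case (pCons a p)
  then obtain f where f: "cyc_mod n dvd p - cyc_poly n f" by blast
  let ?x = "[:1, 1:] :: int poly"
  \<comment> \<open>This represents \<open>a + (x - 1) * p\<close>.\<close>
  let ?h = "\<lambda>i. (if i = 0 then a else 0) + (f ((i + n - 1) mod n) - f i)"
  have "cyc_poly n (\<lambda>i. if i = 0 then a else 0) = (\<Sum>i\<in>{0}. of_int a * ?x ^ i)"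
    unfolding cyc_poly_def using assms by (intro sum.mono_neutral_cong_right) auto
  then have h: "cyc_poly n ?h = of_int a + (cyc_poly n (\<lambda>i. f ((i + n - 1) mod n)) - cyc_poly n f)"
    unfolding cyc_poly_add cyc_poly_diff by simp
  have p: "pCons a p = of_int a + (?x - 1) * p" by (simp add: left_diff_distrib of_int_poly)
  have "of_int a + (x - 1) * p - (of_int a + (s - t)) = (x - 1) * (p - t) + (x * t - s)"
    for x s t :: "int poly" by (simp add: algebra_simps)
  then have "pCons a p - cyc_poly n ?h =
      (?x - 1) * (p - cyc_poly n f) + (?x * cyc_poly n f - cyc_poly n (\<lambda>i. f ((i + n - 1) mod n)))"
    unfolding h p by blast
  then have "cyc_mod n dvd pCons a p - cyc_poly n ?h"
    using dvd_add[OF dvd_mult[OF f] cyc_poly_prev[OF assms, of f]] by (simp only:)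
  then show ?case by blast
qed

lemma degree_linear_power: "degree ([:1, 1:] ^ n :: int poly) = n"
  by (simp add: degree_power_eq)

lemma pcompose_monom: "pcompose (monom a i) r = smult a (r ^ i)"
  for r :: "'a::comm_semiring_1 poly"
  by (induction i) (simp_all add: monom_0 monom_Suc pcompose_pCons)

text \<open>
  The degree of \<open>cyc_poly n f\<close> is below \<open>n\<close>, and the powers of \<open>x\<close> are linearly independent
  because substituting \<open>x = w + 1\<close> is injective.
\<close>

lemma cyc_poly_inj:
  assumes "cyc_mod n dvd cyc_poly n f" and "i < n"
  shows "f i = 0"
proof -
  let ?x = "[:1, 1:] :: int poly"
  have n: "n > 0" using assms by auto
  have deg: "degree (cyc_mod n) = n"
    unfolding cyc_mod_def using n
    by (metis degree_1 degree_add_eq_left degree_linear_power degree_minus diff_conv_add_uminus)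
  have "degree (cyc_poly n f) < n"
    unfolding cyc_poly_def
  proof (rule degree_sum_less[OF _ n])
    fix i assume "i \<in> {..<n}"
    then show "degree (of_int (f i) * ?x ^ i) < n"
      using degree_mult_le[of "of_int (f i)" "?x ^ i"] by (simp add: degree_linear_power)
  qed
  then have "cyc_poly n f = 0"
    using assms(1) deg dvd_imp_degree_le by fastforce
  moreover have "cyc_poly n f = pcompose (\<Sum>i<n. monom (f i) i) ?x"
    unfolding cyc_poly_def pcompose_sum pcompose_monom by (simp add: of_int_poly)
  ultimately have "(\<Sum>i<n. monom (f i) i) = 0"
    using pcompose_eq_0[of "\<Sum>i<n. monom (f i) i" ?x] by simp
  then have "coeff (\<Sum>i<n. monom (f i) i) i = 0" by simp
  then show ?thesis using assms(2) by (simp add: coeff_sum coeff_monom)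
qed

lemma cyc_mod_cancel:
  assumes "n > 0" "cyc_mod n dvd [:1, 1:] * p" shows "cyc_mod n dvd p"
proof -
  obtain k where k: "n = Suc k" using assms(1) by (cases n) auto
  define x :: "int poly" where "x = [:1, 1:]"
  have "p = x ^ k * (x * p) - cyc_mod n * p"
    by (simp add: cyc_mod_def k x_def[symmetric] algebra_simps)
  moreover have "cyc_mod n dvd x ^ k * (x * p) - cyc_mod n * p"
    using assms(2) unfolding x_def[symmetric] by (intro dvd_diff dvd_triv_left dvd_mult[of _ "x * p"])
  ultimately show ?thesis by simp
qed

section \<open>The Laplacian of the product graph\<close>

lemma laplacian_sum:
  fixes G :: "'a pair_pre_digraph" and g :: "'a \<Rightarrow> int"
  assumes "pair_graph G" and u: "u \<in> pverts G" and N: "{v. (u, v) \<in> parcs G} = N"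
  shows "(\<Sum>v\<in>pverts G. laplacian (with_proj G) u v * g v) = of_nat (card N) * g u - (\<Sum>v\<in>N. g v)"
proof -
  interpret pair_graph G by fact
  have NV: "N \<subseteq> pverts G - {u}" using N wellformed' no_loops by (auto dest: pair_no_loops)
  have fin: "finite (pverts G)" by (rule pair_finite_verts)
  have "out_arcs (with_proj G) u = Pair u ` N" using N by (auto simp: out_arcs_def)
  then have deg: "out_degree (with_proj G) u = card N"
    by (simp add: out_degree_def card_image inj_on_def)
  have "{e \<in> parcs G. fst e = u \<and> snd e = v} = (if v \<in> N then {(u, v)} else {})" for v
    using N by auto
  then have off: "laplacian (with_proj G) u v = (if v \<in> N then - 1 else 0)" if "v \<noteq> u" for v
    using that by (simp add: laplacian_def)
  have "(\<Sum>v\<in>pverts G - {u}. laplacian (with_proj G) u v * g v)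
      = (\<Sum>v\<in>pverts G - {u}. (if v \<in> N then - g v else 0))"
    by (rule sum.cong) (auto simp: off)
  then have "(\<Sum>v\<in>pverts G. laplacian (with_proj G) u v * g v)
      = int (card N) * g u + (\<Sum>v\<in>pverts G - {u}. (if v \<in> N then - g v else 0))"
    unfolding sum.remove[OF fin u] by (simp add: laplacian_def deg)
  also have "(\<Sum>v\<in>pverts G - {u}. (if v \<in> N then - g v else 0)) = - (\<Sum>v\<in>N. g v)"
    using NV fin by (simp add: sum.inter_restrict[symmetric] sum_negf Int_absorb1)
  finally show ?thesis by simp
qed

text \<open>
  The product of the complete graph and the cycle.
\<close>

abbreviation (input) prism :: "nat \<Rightarrow> nat \<Rightarrow> (nat \<times> nat) pair_pre_digraph" where
  "prism m n \<equiv> cartesian_product (complete_graph m) (cycle_graph n)"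

lemma laplacian_prism:
  assumes n: "n \<ge> 3" and a: "a < m" and i: "i < n"
  shows "(\<Sum>v\<in>pverts (prism m n). laplacian (with_proj (prism m n)) (a, i) v * g v) =
    (int m + 2) * g (a, i) - (\<Sum>b<m. g (b, i)) - g (a, Suc i mod n) - g (a, (i + n - 1) mod n)"
proof -
  let ?N = "((\<lambda>b. (b, i)) ` ({..<m} - {a})) \<union> {(a, Suc i mod n), (a, (i + n - 1) mod n)}"
  have prev: "(i + n - 1) mod n = (if i = 0 then n - 1 else i - 1)"
    using i n by (cases i) auto
  have next_prev: "j < n \<and> i = Suc j mod n \<longleftrightarrow> j = (i + n - 1) mod n" for j
  proof (cases "j < n")
    case True
    then show ?thesis unfolding prev using i n by (cases "Suc j = n") auto
  next
    case False
    then show ?thesis unfolding prev using i n by auto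
  qed
  have N: "{v. ((a, i), v) \<in> parcs (prism m n)} = ?N"
  proof -
    have "((a, i), (b, j)) \<in> parcs (prism m n) \<longleftrightarrow> (b, j) \<in> ?N" for b j
      using a i n next_prev[of j]
      by (auto simp: cartesian_product_def complete_graph_def cycle_graph_def)
    then show ?thesis by auto
  qed
  have ne: "Suc i mod n \<noteq> (i + n - 1) mod n" "Suc i mod n \<noteq> i" "(i + n - 1) mod n \<noteq> i"
    unfolding prev using i n by (cases "Suc i = n"; auto)+
  have inj: "inj_on (\<lambda>b. (b, i)) ({..<m} - {a})" by (rule inj_onI) simp
  have "card ?N = card ((\<lambda>b. (b, i)) ` ({..<m} - {a})) + 2"
    using ne by (subst card_Un_disjoint) auto
  also have "\<dots> = m + 1" using a by (simp add: card_image[OF inj])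
  finally have card: "card ?N = m + 1" .
  have "(\<Sum>v\<in>?N. g v) = (\<Sum>b\<in>{..<m} - {a}. g (b, i)) + (g (a, Suc i mod n) + g (a, (i + n - 1) mod n))"
    using ne by (subst sum.union_disjoint) (auto simp: sum.reindex[OF inj])
  also have "(\<Sum>b\<in>{..<m} - {a}. g (b, i)) = (\<Sum>b<m. g (b, i)) - g (a, i)"
    using a by (simp add: sum_diff1)
  finally have "(\<Sum>v\<in>?N. g v) = (\<Sum>b<m. g (b, i)) - g (a, i)
      + (g (a, Suc i mod n) + g (a, (i + n - 1) mod n))" .
  moreover have "pair_graph (prism m n)"
    using n by (intro pair_graph_cartesian_product pair_graph_complete_graph pair_graph_cycle_graph) simp
  moreover have "(a, i) \<in> pverts (prism m n)"
    using a i by (simp add: cartesian_product_def complete_graph_def cycle_graph_def)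
  ultimately show ?thesis
    using laplacian_sum[OF _ _ N, of g] card by (simp add: algebra_simps)
qed

text \<open>
  In terms of \<open>x = w + 1\<close> this is \<open>x\<^sup>2 - (m + 2) x + 1\<close>, whose roots are \<open>\<alpha>\<close> and \<open>\<beta>\<close>; this is
  how the recurrent sequences enter.
\<close>

definition quad :: "nat \<Rightarrow> int poly" where
  "quad m = [:- int m, - int m, 1:]"

lemma quad_eq: "quad m = [:0, 1:]\<^sup>2 - of_nat m * [:1, 1:]"
  by (simp add: quad_def power2_eq_square of_nat_poly)

text \<open>
  The first condition describes \<open>m - 2\<close> equal summands and the second one an exceptional
  summand. The elimination takes place among polynomials; it applies since every polynomial is
  congruent to one that represents a function, and a function is determined by its class.
\<close>

lemma laplacian_lattice_prism_iff:
  assumes m: "m \<ge> 3" and n: "n \<ge> 3"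
  defines "P \<equiv> \<lambda>f a. cyc_poly n (\<lambda>i. f (a, i))"
  shows "f \<in> laplacian_lattice (with_proj (prism m n)) \<longleftrightarrow>
     (\<forall>a\<in>{2..<m}. P f a - P f 1 \<in> ideal2 (quad m) (cyc_mod n)) \<and>
     [:1, 1:] * (\<Sum>a<m. P f a) - [:0, 1:]\<^sup>2 * P f 1 \<in> ideal2 ([:0, 1:]\<^sup>2 * quad m) (cyc_mod n)"
proof -
  define x :: "int poly" where "x = [:1, 1:]"
  define E where "E = cyc_mod n"
  define q where "q = quad m"
  have n0: "n > 0" using n by simp
  have E: "x * x ^ (n - 1) = 1 + E"
    using power_minus_mult[OF n0, of x] by (simp add: E_def cyc_mod_def x_def[symmetric] mult.commute)
  have w: "[:0, 1:] = x - 1" by (simp add: x_def one_pCons del: pCons_one)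
  have q: "q = (x - 1)\<^sup>2 - of_nat m * x" by (simp add: q_def quad_eq x_def[symmetric] w)
  define L where "L g = (\<lambda>(a, i). (int m + 2) * g (a, i) - (\<Sum>b<m. g (b, i))
      - g (a, Suc i mod n) - g (a, (i + n - 1) mod n))" for g :: "nat \<times> nat \<Rightarrow> int"
  have lattice: "f \<in> laplacian_lattice (with_proj (prism m n)) \<longleftrightarrow>
      (\<exists>g. \<forall>a<m. \<forall>i<n. f (a, i) = L g (a, i))"
  proof -
    have V: "pverts (prism m n) = {..<m} \<times> {..<n}"
      by (simp add: cartesian_product_def complete_graph_def cycle_graph_def)
    have "(\<forall>u\<in>pverts (prism m n). f u =
          (\<Sum>v\<in>pverts (prism m n). laplacian (with_proj (prism m n)) u v * g v)) \<longleftrightarrow>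
        (\<forall>a<m. \<forall>i<n. f (a, i) = L g (a, i))" for g
      using laplacian_prism[OF n, of _ m _ g] unfolding L_def V by auto
    then show ?thesis unfolding laplacian_lattice_def by simp
  qed
  have L: "E dvd x * P (L g) a + q * P g a + x * (\<Sum>b<m. P g b)" for g a
  proof -
    let ?next = "cyc_poly n (\<lambda>i. g (a, Suc i mod n))"
    let ?prev = "cyc_poly n (\<lambda>i. g (a, (i + n - 1) mod n))"
    have PL: "P (L g) a = (of_nat m + 2) * P g a - (\<Sum>b<m. P g b) - ?next - ?prev"
      unfolding P_def L_def by (simp add: cyc_poly_diff cyc_poly_scale cyc_poly_sum)
    have "x * P (L g) a + q * P g a + x * (\<Sum>b<m. P g b)
        = x * (x * P g a - ?prev) - (x * ?next - P g a)"
      unfolding PL q by (simp add: algebra_simps power2_eq_square)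
    moreover have "E dvd x * P g a - ?prev"
      unfolding E_def x_def P_def by (rule cyc_poly_prev[OF n0])
    moreover have "E dvd x * ?next - P g a"
      unfolding E_def x_def P_def cyc_poly_next[OF n0, of "\<lambda>i. g (a, i)"] by simp
    ultimately show ?thesis by (simp add: dvd_diff)
  qed
  have "f \<in> laplacian_lattice (with_proj (prism m n)) \<longleftrightarrow>
      (\<exists>g. \<forall>a<m. E dvd x * P f a + q * g a + x * (\<Sum>b<m. g b))"
    unfolding lattice
  proof
    assume "\<exists>g. \<forall>a<m. \<forall>i<n. f (a, i) = L g (a, i)"
    then obtain g where g: "\<And>a i. a < m \<Longrightarrow> i < n \<Longrightarrow> f (a, i) = L g (a, i)" by blast
    have "P f a = P (L g) a" if "a < m" for a
      unfolding P_def using g that by (intro cyc_poly_cong) simp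
    then show "\<exists>g. \<forall>a<m. E dvd x * P f a + q * g a + x * (\<Sum>b<m. g b)"
      using L by (intro exI[of _ "P g"]) simp
  next
    assume "\<exists>g. \<forall>a<m. E dvd x * P f a + q * g a + x * (\<Sum>b<m. g b)"
    then obtain g where g: "\<And>a. a < m \<Longrightarrow> E dvd x * P f a + q * g a + x * (\<Sum>b<m. g b)" by blast
    have "\<forall>a. \<exists>h. E dvd g a - cyc_poly n h"
      using cyc_poly_surj[OF n0] unfolding E_def by blast
    then obtain h where h: "\<And>a. E dvd g a - cyc_poly n (h a)" by metis
    define h' where "h' = (\<lambda>(a, i). h a i)"
    have h': "E dvd g a - P h' a" for a using h unfolding P_def h'_def by simp
    have "f (a, i) = L h' (a, i)" if a: "a < m" and i: "i < n" for a i
    proof -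
      have "x * (P f a - P (L h') a) =
          (x * P f a + q * g a + x * (\<Sum>b<m. g b))
          - (x * P (L h') a + q * P h' a + x * (\<Sum>b<m. P h' b))
          - q * (g a - P h' a) - x * (\<Sum>b<m. g b - P h' b)"
        by (simp add: sum_subtractf algebra_simps)
      moreover have "E dvd \<dots>"
        by (intro dvd_diff g[OF a] L dvd_mult[OF h'] dvd_mult[OF dvd_sum[OF h']])
      ultimately have "E dvd x * (P f a - P (L h') a)" by (simp only:)
      then have "cyc_mod n dvd P f a - P (L h') a"
        unfolding E_def x_def by (rule cyc_mod_cancel[OF n0])
      then have "cyc_mod n dvd cyc_poly n (\<lambda>i. f (a, i) - L h' (a, i))"
        unfolding P_def by (simp add: cyc_poly_diff)
      from cyc_poly_inj[OF this i] show ?thesis by simp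
    qed
    then show "\<exists>g. \<forall>a<m. \<forall>i<n. f (a, i) = L g (a, i)" by blast
  qed
  also have "\<dots> \<longleftrightarrow> (\<forall>a\<in>{2..<m}. P f a - P f 1 \<in> ideal2 q E) \<and>
     x * (\<Sum>a<m. P f a) - (x - 1)\<^sup>2 * P f 1 \<in> ideal2 ((x - 1)\<^sup>2 * q) E"
    using m by (intro eliminate_complete_graph[OF _ E refl q]) simp
  finally show ?thesis unfolding E_def q_def w x_def .
qed

lemma quot_cyclic_power:
  fixes I :: "'a::ab_group_add set"
  assumes "quot_cyclic I ks" "add_subgroup I"
  shows "quot_cyclic {f :: nat \<Rightarrow> 'a. \<forall>a<k. f a \<in> I} (concat (replicate k ks))"
proof (induction k)
  case 0
  then show ?case
    unfolding quot_cyclic_def coordinates_def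
    by (intro exI[of _ "\<lambda>_ _. 0"]) (simp add: diag_lattice_def)
next
  case (Suc k)
  let ?K = "\<lambda>k. {f :: nat \<Rightarrow> 'a. \<forall>a<k. f a \<in> I}"
  have K: "add_subgroup (?K k)" using assms(2) by (simp add: add_subgroup_def)
  have "quot_cyclic (?K (Suc k)) (ks @ concat (replicate k ks))"
  proof (rule quot_cyclic_join[OF assms(1) Suc.IH assms(2) K,
        where \<theta> = "\<lambda>f. f k" and \<eta> = "\<lambda>f. f"])
    show "\<exists>f. f k - p \<in> I \<and> f - g \<in> ?K k" for p and g :: "nat \<Rightarrow> 'a"
      using assms(2) by (intro exI[of _ "g(k := p)"]) (simp add: add_subgroup_def)
  qed (auto simp: less_Suc_eq)
  then show ?case by simp
qed

text \<open>
  Joint surjectivity holds because the values over the vertices \<open>2, ..., m - 1\<close> of the complete graph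
  can be prescribed freely and the value over the vertex 0 then adjusts the weighted sum.
\<close>

lemma quot_cyclic_prism:
  assumes m: "m \<ge> 3" and n: "n \<ge> 3"
    and Q: "quot_cyclic (ideal2 (quad m) (cyc_mod n)) ks"
    and Q': "quot_cyclic (ideal2 ([:0, 1:]\<^sup>2 * quad m) (cyc_mod n)) ls"
  shows "quot_cyclic (laplacian_lattice (with_proj (prism m n))) (ls @ concat (replicate (m - 2) ks))"
proof -
  define x :: "int poly" where "x = [:1, 1:]"
  define w :: "int poly" where "w = [:0, 1:]"
  define P where "P = (\<lambda>(f :: nat \<times> nat \<Rightarrow> int) a. cyc_poly n (\<lambda>i. f (a, i)))"
  let ?I = "ideal2 (quad m) (cyc_mod n)" and ?J = "ideal2 (w\<^sup>2 * quad m) (cyc_mod n)"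
  let ?K = "{h. \<forall>a<m - 2. h a \<in> ?I}"
  have n0: "n > 0" using n by simp
  have Padd: "P (f + g) a = P f a + P g a" for f g a
    unfolding P_def by (simp add: cyc_poly_add)
  show ?thesis
  proof (rule quot_cyclic_join[OF Q'[folded w_def] quot_cyclic_power[OF Q add_subgroup_ideal2],
        where \<theta> = "\<lambda>f. x * (\<Sum>a<m. P f a) - w\<^sup>2 * P f 1" and \<eta> = "\<lambda>f a. P f (a + 2) - P f 1"])
    show "add_subgroup ?J" by (rule add_subgroup_ideal2)
    show "add_subgroup ?K" using add_subgroup_ideal2[of "quad m" "cyc_mod n"]
      by (simp add: add_subgroup_def)
    show "x * (\<Sum>a<m. P (f + g) a) - w\<^sup>2 * P (f + g) 1 =
        (x * (\<Sum>a<m. P f a) - w\<^sup>2 * P f 1) + (x * (\<Sum>a<m. P g a) - w\<^sup>2 * P g 1)" for f g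
      by (simp add: Padd sum.distrib algebra_simps)
    show "(\<lambda>a. P (f + g) (a + 2) - P (f + g) 1) =
        (\<lambda>a. P f (a + 2) - P f 1) + (\<lambda>a. P g (a + 2) - P g 1)" for f g
      by (simp add: fun_eq_iff Padd)
    show "f \<in> laplacian_lattice (with_proj (prism m n)) \<longleftrightarrow>
        x * (\<Sum>a<m. P f a) - w\<^sup>2 * P f 1 \<in> ?J \<and> (\<lambda>a. P f (a + 2) - P f 1) \<in> ?K" for f
    proof -
      have "(\<forall>a\<in>{2..<m}. P f a - P f 1 \<in> ?I) \<longleftrightarrow> (\<forall>a<m - 2. P f (a + 2) - P f 1 \<in> ?I)"
      proof
        assume R: "\<forall>a<m - 2. P f (a + 2) - P f 1 \<in> ?I"
        show "\<forall>a\<in>{2..<m}. P f a - P f 1 \<in> ?I"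
        proof
          fix a assume "a \<in> {2..<m}"
          then have "a - 2 < m - 2" "a - 2 + 2 = a" by auto
          then show "P f a - P f 1 \<in> ?I" using R by metis
        qed
      qed auto
      then show ?thesis
        using laplacian_lattice_prism_iff[OF m n, of f] unfolding P_def x_def w_def by auto
    qed
    show "\<exists>f. (x * (\<Sum>a<m. P f a) - w\<^sup>2 * P f 1) - p \<in> ?J \<and>
        (\<lambda>a. P f (a + 2) - P f 1) - h \<in> ?K" for p and h :: "nat \<Rightarrow> int poly"
    proof -
      have "\<forall>r. \<exists>c. cyc_mod n dvd r - cyc_poly n c" using cyc_poly_surj[OF n0] by blast
      then obtain c where c: "\<And>r. cyc_mod n dvd r - cyc_poly n (c r)" by metis
      define R where "R a = (if a = 0 then x ^ (n - 1) * p - (\<Sum>b\<in>{2..<m}. h (b - 2))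
          else if a = 1 then 0 else h (a - 2))" for a
      define f where "f = (\<lambda>(a, i). c (R a) i)"
      have PR: "cyc_mod n dvd P f a - R a" for a
      proof -
        have "P f a = cyc_poly n (c (R a))" by (simp add: P_def f_def)
        then show ?thesis using c[of "R a"] by (metis dvd_minus_iff minus_diff_eq)
      qed
      have "(\<Sum>a<m. R a) = x ^ (n - 1) * p"
        using m by (subst sum_lessThan_split_two) (simp_all add: R_def)
      then have "(x * (\<Sum>a<m. P f a) - w\<^sup>2 * P f 1) - p =
          x * (\<Sum>a<m. P f a - R a) - w\<^sup>2 * (P f 1 - R 1) + (x * x ^ (n - 1) - 1) * p"
        by (simp add: sum_subtractf R_def algebra_simps)
      also have "x * x ^ (n - 1) - 1 = cyc_mod n"
        using power_minus_mult[OF n0, of x] by (simp add: cyc_mod_def x_def[symmetric] mult.commute)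
      finally have "(x * (\<Sum>a<m. P f a) - w\<^sup>2 * P f 1) - p =
          x * (\<Sum>a<m. P f a - R a) - w\<^sup>2 * (P f 1 - R 1) + cyc_mod n * p" .
      moreover have "cyc_mod n dvd \<dots>"
        by (intro dvd_add dvd_diff dvd_triv_left dvd_mult[OF PR] dvd_mult[OF dvd_sum[OF PR]])
      ultimately have "cyc_mod n dvd (x * (\<Sum>a<m. P f a) - w\<^sup>2 * P f 1) - p" by (simp only:)
      moreover have "cyc_mod n dvd P f (a + 2) - P f 1 - h a" for a
      proof -
        have "P f (a + 2) - P f 1 - h a = (P f (a + 2) - R (a + 2)) - (P f 1 - R 1)"
          by (simp add: R_def)
        then show ?thesis using PR by (metis dvd_diff)
      qed
      ultimately show ?thesis
        by (intro exI[of _ f]) (auto intro!: ideal2_right)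
    qed
  qed
qed

section \<open>Triangular lattices in rank three, and remainders modulo monic polynomials\<close>

text \<open>
  The row lattice of the matrix with rows \<open>(a, b, c)\<close>, \<open>(0, d, 0)\<close> and \<open>(0, 0, e)\<close>.
\<close>

definition triangular_lattice3 :: "int \<Rightarrow> int \<Rightarrow> int \<Rightarrow> int \<Rightarrow> int \<Rightarrow> ((int \<times> int) \<times> int) set" where
  "triangular_lattice3 a b c d e = {((a * k, b * k + d * l), c * k + e * r) | k l r. True}"

lemma add_subgroup_triangular3: "add_subgroup (triangular_lattice3 a b c d e)"
  unfolding add_subgroup_def
proof (intro conjI ballI)
  show "0 \<in> triangular_lattice3 a b c d e"
    unfolding triangular_lattice3_def zero_prod_def by (auto intro: exI[of _ 0])
  fix x y assume "x \<in> triangular_lattice3 a b c d e" "y \<in> triangular_lattice3 a b c d e"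
  then obtain k l r k' l' r' where "x = ((a * k, b * k + d * l), c * k + e * r)"
    "y = ((a * k', b * k' + d * l'), c * k' + e * r')"
    unfolding triangular_lattice3_def by blast
  then have "x - y = ((a * (k - k'), b * (k - k') + d * (l - l')), c * (k - k') + e * (r - r'))"
    by (simp add: algebra_simps)
  then show "x - y \<in> triangular_lattice3 a b c d e"
    unfolding triangular_lattice3_def by blast
qed

text \<open>
  Bezout coefficients of \<open>e\<close> and \<open>c\<close> combine the first and the last row into one with last entry
  \<open>t = gcd e c\<close> and one that is \<open>f\<close> times \<open>(a, b, 0)\<close>. As \<open>t\<close> divides \<open>a\<close> and \<open>b\<close>, the former splits off a
  summand \<open>\<int>/t\<close>; what remains is the triangular lattice of rank two scaled by \<open>f\<close>.
\<close>

lemma quot_cyclic_triangular3: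
  assumes ne: "a \<noteq> 0" "f \<noteq> 0"
    and t: "t = gcd e c" "t dvd a" "t dvd b" and e: "e = t * f" and d: "d = f * K"
    and K: "gcd a b dvd K"
  shows "quot_cyclic (triangular_lattice3 a b c d e)
    [gcd (f * a) (f * b), (f * a) * (f * K) div gcd (f * a) (f * b), t]"
proof -
  obtain a' b' c' where abc: "a = t * a'" "b = t * b'" "c = t * c'"
    using t by (meson dvdE gcd_dvd2)
  obtain \<alpha> \<beta> where bezout: "\<alpha> * e + \<beta> * c = t" unfolding t(1) using bezout_int by blast
  define \<theta> where "\<theta> = (\<lambda>((X, Y), Z). (X - Z * \<beta> * a', Y - Z * \<beta> * b'))"
  have \<theta>: "\<theta> ((X, Y), Z) = (X - Z * \<beta> * a', Y - Z * \<beta> * b')" for X Y Z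
    by (simp add: \<theta>_def)
  have "quot_cyclic (triangular_lattice3 a b c d e)
    ([gcd (f * a) (f * b), (f * a) * (f * K) div gcd (f * a) (f * b)] @ [t])"
  proof (rule quot_cyclic_join[OF quot_cyclic_triangular quot_cyclic_int add_subgroup_triangular
        add_subgroup_multiples, where \<theta> = \<theta> and \<eta> = snd])
    show "f * a \<noteq> 0" using ne by simp
    have "gcd (f * a) (f * b) = \<bar>f\<bar> * gcd a b" by (simp add: gcd_mult_distrib_int abs_mult)
    then show "gcd (f * a) (f * b) dvd f * K" using K by (simp add: mult_dvd_mono)
    show "\<theta> (v + v') = \<theta> v + \<theta> v'" for v v'
      by (auto simp: \<theta>_def algebra_simps split: prod.splits)
    show "\<exists>x. \<theta> x - v \<in> triangular_lattice (f * a) (f * b) (f * K) \<and> snd x - z \<in> {x. t dvd x}" for v z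
    proof -
      obtain X Y where v: "v = (X, Y)" by fastforce
      show ?thesis
        using add_subgroup_triangular[of "f * a" "f * b" "f * K"]
        by (intro exI[of _ "((X + z * \<beta> * a', Y + z * \<beta> * b'), z)"])
          (simp add: v \<theta> add_subgroup_def zero_prod_def)
    qed
    show "v \<in> triangular_lattice3 a b c d e \<longleftrightarrow>
        \<theta> v \<in> triangular_lattice (f * a) (f * b) (f * K) \<and> snd v \<in> {x. t dvd x}" for v
    proof -
      obtain X Y Z where v: "v = ((X, Y), Z)" by (metis prod.exhaust)
      show ?thesis
      proof
        assume "v \<in> triangular_lattice3 a b c d e"
        then obtain k l r where XYZ: "X = a * k" "Y = b * k + d * l" "Z = c * k + e * r"
          unfolding triangular_lattice3_def v by blast
        have "t * k - Z * \<beta> = (\<alpha> * e + \<beta> * c) * k - Z * \<beta>" unfolding bezout ..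
        then have k: "t * k - Z * \<beta> = t * f * (\<alpha> * k - \<beta> * r)"
          unfolding XYZ(3) e by (simp add: algebra_simps)
        have "X - Z * \<beta> * a' = (t * k - Z * \<beta>) * a'" "Y - Z * \<beta> * b' = (t * k - Z * \<beta>) * b' + d * l"
          unfolding XYZ(1,2) abc(1,2) by (simp_all add: algebra_simps)
        then have "X - Z * \<beta> * a' = f * a * (\<alpha> * k - \<beta> * r)"
          "Y - Z * \<beta> * b' = f * b * (\<alpha> * k - \<beta> * r) + f * K * l"
          unfolding k d abc(1,2) by (simp_all add: algebra_simps)
        moreover have "t dvd Z" unfolding XYZ(3) e abc(3) by (simp add: dvd_add)
        ultimately show "\<theta> v \<in> triangular_lattice (f * a) (f * b) (f * K) \<and> snd v \<in> {x. t dvd x}"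
          unfolding v \<theta> triangular_lattice_def by auto
      next
        assume "\<theta> v \<in> triangular_lattice (f * a) (f * b) (f * K) \<and> snd v \<in> {x. t dvd x}"
        then obtain k l z where kl: "X - Z * \<beta> * a' = f * a * k" "Y - Z * \<beta> * b' = f * b * k + f * K * l"
          and Z: "Z = t * z"
          unfolding v \<theta> triangular_lattice_def by (auto elim!: dvdE)
        have "X = a * (\<beta> * z + f * k)" "Y = b * (\<beta> * z + f * k) + d * l"
          using kl unfolding Z abc(1,2) d by (simp_all add: algebra_simps)
        moreover have "Z = c * (\<beta> * z + f * k) + e * (\<alpha> * z - c' * k)"
        proof -
          have "c * (\<beta> * z + f * k) + e * (\<alpha> * z - c' * k) = (\<alpha> * e + \<beta> * c) * z + (c * f - e * c') * k"
            by (simp add: algebra_simps)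
          also have "c * f - e * c' = 0" unfolding e abc(3) by simp
          finally show ?thesis unfolding bezout Z by simp
        qed
        ultimately show "v \<in> triangular_lattice3 a b c d e"
          unfolding v triangular_lattice3_def by blast
      qed
    qed
  qed simp
  then show ?thesis by simp
qed

lemma monic_remainder:
  fixes g :: "int poly"
  assumes g: "lead_coeff g = 1" "degree g > 0"
  shows "degree (pseudo_mod p g) < degree g" and "g dvd p - pseudo_mod p g"
proof -
  obtain k r where kr: "pseudo_divmod p g = (k, r)" by fastforce
  have g0: "g \<noteq> 0" using g by auto
  have "p = g * k + r" "r = 0 \<or> degree r < degree g"
    using pseudo_divmod[OF g0 kr] g by simp_all
  moreover have "pseudo_mod p g = r" using kr by (simp add: pseudo_mod_def)
  ultimately show "degree (pseudo_mod p g) < degree g" "g dvd p - pseudo_mod p g"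
    using g by auto
qed

lemma monic_dvd_small:
  fixes g :: "int poly"
  assumes "g dvd r" "degree r < degree g"
  shows "r = 0"
  using assms dvd_imp_degree_le leD by blast

text \<open>
  Modulo a monic \<open>g\<close> every polynomial has a unique remainder of smaller degree, so membership in
  the ideal generated by \<open>g\<close> and \<open>b\<close> is a condition on the finitely many coefficients of the
  remainder.
\<close>

lemma quot_cyclic_remainder:
  fixes g :: "int poly" and \<rho> :: "int poly \<Rightarrow> 'b::ab_group_add"
  assumes g: "lead_coeff g = 1" "degree g > 0"
    and Q: "quot_cyclic \<Lambda> ks" "add_subgroup \<Lambda>"
    and add: "\<And>p p'. \<rho> (p + p') = \<rho> p + \<rho> p'"
    and surj: "\<And>z. \<exists>r. degree r < degree g \<and> \<rho> r = z"
    and iff: "\<And>r. degree r < degree g \<Longrightarrow>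
      (\<exists>l. degree l < degree g \<and> g dvd r - b * l) \<longleftrightarrow> \<rho> r \<in> \<Lambda>"
  shows "quot_cyclic (ideal2 g b) ks"
proof (rule quot_cyclic_vimage[OF Q, where \<theta> = "\<lambda>p. \<rho> (pseudo_mod p g)"])
  note rem = monic_remainder[OF g]
  have rem_unique: "pseudo_mod p g = r" if "g dvd p - r" "degree r < degree g" for p r
  proof -
    have "g dvd (p - r) - (p - pseudo_mod p g)" using that(1) rem(2) by (rule dvd_diff)
    then have "pseudo_mod p g - r = 0"
      using that(2) rem(1)[of p] by (intro monic_dvd_small[of g]) (auto intro: degree_diff_less)
    then show ?thesis by simp
  qed
  show "\<rho> (pseudo_mod (p + p') g) = \<rho> (pseudo_mod p g) + \<rho> (pseudo_mod p' g)" for p p'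
  proof -
    have "g dvd (p - pseudo_mod p g) + (p' - pseudo_mod p' g)" by (intro dvd_add rem(2))
    then have "pseudo_mod (p + p') g = pseudo_mod p g + pseudo_mod p' g"
      by (intro rem_unique degree_add_less rem(1)) (simp add: algebra_simps)
    then show ?thesis by (simp add: add)
  qed
  show "\<exists>p. \<rho> (pseudo_mod p g) - z \<in> \<Lambda>" for z
  proof -
    obtain r where r: "degree r < degree g" "\<rho> r = z" using surj by blast
    have "pseudo_mod r g = r" using r(1) by (intro rem_unique) simp
    then show ?thesis using r(2) Q(2) by (intro exI[of _ r]) (simp add: add_subgroup_def)
  qed
  show "p \<in> ideal2 g b \<longleftrightarrow> \<rho> (pseudo_mod p g) \<in> \<Lambda>" for p
  proof -
    have "p \<in> ideal2 g b \<longleftrightarrow> (\<exists>l. degree l < degree g \<and> g dvd pseudo_mod p g - b * l)"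
    proof
      assume "p \<in> ideal2 g b"
      then obtain k l where p: "p = g * k + b * l" by (rule ideal2E)
      have "g dvd g * k + b * (l - pseudo_mod l g) - (p - pseudo_mod p g)"
        by (intro dvd_diff dvd_add dvd_triv_left dvd_mult rem(2))
      moreover have "g * k + b * (l - pseudo_mod l g) - (p - pseudo_mod p g)
          = pseudo_mod p g - b * pseudo_mod l g"
        unfolding p by (simp add: algebra_simps)
      ultimately show "\<exists>l. degree l < degree g \<and> g dvd pseudo_mod p g - b * l"
        using rem(1) by auto
    next
      assume "\<exists>l. degree l < degree g \<and> g dvd pseudo_mod p g - b * l"
      then obtain l where "g dvd pseudo_mod p g - b * l" by blast
      then have "g dvd (p - pseudo_mod p g) + (pseudo_mod p g - b * l)"
        using rem(2) by (intro dvd_add)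
      then obtain k where "p - b * l = g * k" by (auto elim: dvdE)
      then show "p \<in> ideal2 g b" by (intro ideal2I[of _ _ k _ l]) (simp add: algebra_simps)
    qed
    then show ?thesis using iff[OF rem(1)] by simp
  qed
qed

text \<open>
  Modulo \<open>g\<close> the element \<open>x\<close> is a unit with inverse \<open>x'\<close>, so powers of \<open>x\<close> can be cancelled.
\<close>

lemma ideal2_unit_multiple_subset:
  fixes g :: "'a::comm_ring_1"
  assumes inv: "g dvd x * x' - 1" and bc: "g dvd x ^ i * b - x ^ j * c"
  shows "ideal2 g b \<subseteq> ideal2 g c"
proof
  fix p assume "p \<in> ideal2 g b"
  then obtain k l where p: "p = g * k + b * l" by (rule ideal2E)
  have "g dvd (x * x') ^ i - 1"
  proof (induction i)
    case (Suc i)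
    have "(x * x') ^ Suc i - 1 = (x * x') * ((x * x') ^ i - 1) + (x * x' - 1)"
      by (simp add: algebra_simps)
    then show ?case using dvd_add[OF dvd_mult[OF Suc] inv] by (simp only:)
  qed simp
  then have "g dvd x' ^ i * (x ^ i * b - x ^ j * c) - ((x * x') ^ i - 1) * b"
    using bc by (intro dvd_diff) simp_all
  moreover have "x' ^ i * (x ^ i * b - x ^ j * c) - ((x * x') ^ i - 1) * b = b - c * (x' ^ i * x ^ j)"
    by (simp add: algebra_simps power_mult_distrib)
  ultimately obtain r where "b - c * (x' ^ i * x ^ j) = g * r" by (auto elim: dvdE)
  then have b: "b = g * r + c * (x' ^ i * x ^ j)" by (simp add: algebra_simps)
  show "p \<in> ideal2 g c"
    by (rule ideal2I[of _ _ "k + r * l" _ "x' ^ i * x ^ j * l"])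
      (unfold p, subst b, simp add: algebra_simps)
qed

lemma ideal2_unit_multiple:
  fixes g :: "'a::comm_ring_1"
  assumes "g dvd x * x' - 1" and "g dvd x ^ i * b - x ^ j * c"
  shows "ideal2 g b = ideal2 g c"
proof -
  have "g dvd x ^ j * c - x ^ i * b" using assms(2) by (metis dvd_minus_iff minus_diff_eq)
  then show ?thesis
    using ideal2_unit_multiple_subset[OF assms] ideal2_unit_multiple_subset[OF assms(1)] by blast
qed

section \<open>The sequences as values of power sums\<close>

lemma u_seq_0 [simp]: "u_seq m 0 = 0"
  by (simp add: u_seq_def)

lemma u_seq_1:
  assumes "m > 0" shows "u_seq m 1 = 1"
proof -
  have "sqrt (real m ^ 2 + 4 * real m) > 0" using assms by (simp add: add_nonneg_pos)
  then have "alpha m - beta m \<noteq> 0" unfolding alpha_def beta_def by (simp add: field_simps)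
  then have "real_of_int (u_seq m 1) = 1" using of_int_u_seq[OF assms, of 1] by simp
  then show ?thesis by simp
qed

text \<open>
  Both \<open>\<alpha>\<close> and \<open>\<beta>\<close> are roots of \<open>x\<^sup>2 - (m + 2) x + 1\<close>.
\<close>

lemma u_seq_rec:
  assumes "m > 0"
  shows "u_seq m (int (Suc (Suc k))) = (int m + 2) * u_seq m (int (Suc k)) - u_seq m (int k)"
proof -
  have pow: "x ^ Suc (Suc k) = (real m + 2) * x ^ Suc k - x ^ k"
    if "x = alpha m \<or> x = beta m" for x
  proof -
    have "x * x = (real m + 2) * x - 1"
      using that alpha_times_beta[of m] alpha_plus_beta[of m, symmetric] by (auto simp: algebra_simps)
    then have "x ^ k * (x * x) = x ^ k * ((real m + 2) * x - 1)" by simp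
    then show ?thesis by (simp add: algebra_simps)
  qed
  have u: "real_of_int (u_seq m (int k)) = (alpha m ^ k - beta m ^ k) / (alpha m - beta m)" for k
    using of_int_u_seq[OF assms, of "int k"] by simp
  have "real_of_int (u_seq m (int (Suc (Suc k)))) =
      real_of_int ((int m + 2) * u_seq m (int (Suc k)) - u_seq m (int k))"
    unfolding of_int_diff of_int_mult u pow[OF disjI1[OF refl]] pow[OF disjI2[OF refl]]
    by (simp add: diff_divide_distrib[symmetric] algebra_simps)
  then show ?thesis unfolding of_int_eq_iff .
qed

lemma u_seq_mono:
  assumes "m > 0"
  shows "0 \<le> u_seq m (int k) \<and> u_seq m (int k) < u_seq m (int (Suc k))"
proof (induction k)
  case 0
  then show ?case using u_seq_1[OF assms] by simp
next
  case (Suc k)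
  have "u_seq m (int (Suc (Suc k))) - u_seq m (int (Suc k))
      = int m * u_seq m (int (Suc k)) + (u_seq m (int (Suc k)) - u_seq m (int k))"
    unfolding u_seq_rec[OF assms] by (simp add: algebra_simps)
  moreover have "0 \<le> int m * u_seq m (int (Suc k))" using Suc by simp
  ultimately show ?case using Suc by linarith
qed

lemma u_seq_pos: "m > 0 \<Longrightarrow> k > 0 \<Longrightarrow> u_seq m (int k) > 0"
  using u_seq_mono[of m "k - 1"] by simp

lemma tau_seq_0 [simp]: "tau_seq m 0 = 0"
  by (simp add: tau_seq_def)

lemma tau_seq_1: "m > 0 \<Longrightarrow> tau_seq m 1 = 0"
  by (simp add: tau_seq_def u_seq_1)

lemma tau_seq_rec:
  assumes "m > 0"
  shows "tau_seq m (int (Suc (Suc k))) =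
    (int m + 2) * tau_seq m (int (Suc k)) - tau_seq m (int k) - int (Suc k)"
proof -
  note mt = m_times_tau_seq[OF assms]
  have "int m * tau_seq m (int (Suc (Suc k))) =
      (int m + 2) * (int m * tau_seq m (int (Suc k))) - int m * tau_seq m (int k) - int m * int (Suc k)"
    unfolding mt u_seq_rec[OF assms] by (simp add: algebra_simps)
  also have "\<dots> = int m * ((int m + 2) * tau_seq m (int (Suc k)) - tau_seq m (int k) - int (Suc k))"
    by (simp add: algebra_simps)
  finally show ?thesis using assms by simp
qed

text \<open>
  Put \<open>x = 1 + w\<close> and \<open>y = x + 1/x - 2\<close>. The Laurent polynomials
  \<open>(x\<^sup>k - 1/x\<^sup>k) / (x - 1/x)\<close> satisfy a recurrence with factor \<open>x + 1/x = y + 2\<close>. Modulo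
  \<open>w q\<close> one has \<open>y\<^sup>2 = m y\<close>, so they reduce to \<open>k - t\<^sub>k y\<close> with an integer sequence \<open>t\<^sub>k\<close>
  satisfying the recurrence of \<open>tau_seq\<close>. This identity is one step of that recurrence, cleared of
  denominators.
\<close>

lemma power_sum_step:
  fixes w \<mu> t0 t1 k :: "'a::comm_ring_1"
  defines "x \<equiv> 1 + w" and "y \<equiv> w\<^sup>2 - \<mu> * w" and "q \<equiv> w\<^sup>2 - \<mu> * w - \<mu>"
  shows "x * (k + 2 - ((\<mu> + 2) * t1 - t0 - (k + 1)) * y) =
    (x\<^sup>2 + 1) * (k + 1 - t1 * y) - x * (k - t0 * y)
      + w * q * ((k + 1 - t1 * y) + t1 * x * (w - \<mu>))"
  unfolding x_def y_def q_def by (simp add: algebra_simps power2_eq_square)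

text \<open>
  Up to the unit \<open>x ^ (k - 1)\<close>, the sum of the even powers is
  \<open>(x\<^sup>k - 1/x\<^sup>k) / (x - 1/x)\<close>; the factor \<open>x\<close> on the left avoids the exponent \<open>k - 1\<close>.
\<close>

lemma sum_even_powers:
  fixes w :: "'a::comm_ring_1"
  assumes m: "m > 0"
  defines "\<mu> \<equiv> of_nat m" and "x \<equiv> 1 + w"
  defines "y \<equiv> w\<^sup>2 - \<mu> * w" and "q \<equiv> w\<^sup>2 - \<mu> * w - \<mu>"
  shows "w * q dvd x * (\<Sum>i<k. x ^ (2 * i)) - x ^ k * (of_nat k - of_int (tau_seq m (int k)) * y)"
    (is "?P k")
proof -
  define M where "M k = (\<Sum>i<k. x ^ (2 * i))" for k
  define B where "B k = of_nat k - of_int (tau_seq m (int k)) * y" for k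
  have step: "w * q dvd x * M (Suc (Suc k)) - x ^ Suc (Suc k) * B (Suc (Suc k))"
    if "w * q dvd x * M k - x ^ k * B k" "w * q dvd x * M (Suc k) - x ^ Suc k * B (Suc k)" for k
  proof -
    have M: "M (Suc (Suc k)) = (x\<^sup>2 + 1) * M (Suc k) - x\<^sup>2 * M k"
      unfolding M_def by (simp add: power2_eq_square algebra_simps)
    have "B (Suc (Suc k)) = of_nat k + 2
        - ((\<mu> + 2) * of_int (tau_seq m (int (Suc k))) - of_int (tau_seq m (int k)) - (of_nat k + 1)) * y"
      unfolding B_def tau_seq_rec[OF m] \<mu>_def by (simp add: algebra_simps)
    then have "x * B (Suc (Suc k)) = (x\<^sup>2 + 1) * (of_nat k + 1 - of_int (tau_seq m (int (Suc k))) * y)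
        - x * (of_nat k - of_int (tau_seq m (int k)) * y)
        + w * q * ((of_nat k + 1 - of_int (tau_seq m (int (Suc k))) * y)
          + of_int (tau_seq m (int (Suc k))) * x * (w - \<mu>))"
      unfolding x_def y_def q_def by (simp only: power_sum_step)
    then obtain C where B: "x * B (Suc (Suc k)) = (x\<^sup>2 + 1) * B (Suc k) - x * B k + w * q * C"
      unfolding B_def by (auto simp: add.commute[of 1])
    have "x * M (Suc (Suc k)) - x ^ Suc k * (x * B (Suc (Suc k)))
        = (x\<^sup>2 + 1) * (x * M (Suc k) - x ^ Suc k * B (Suc k)) - x\<^sup>2 * (x * M k - x ^ k * B k)
          - w * q * (x ^ Suc k * C)"
      unfolding M B by (simp add: algebra_simps power2_eq_square)
    moreover have "w * q dvd \<dots>"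
      by (intro dvd_diff dvd_triv_left dvd_mult[OF that(1)] dvd_mult[OF that(2)])
    moreover have "x ^ Suc k * (x * B (Suc (Suc k))) = x ^ Suc (Suc k) * B (Suc (Suc k))"
      by (simp add: ac_simps)
    ultimately show ?thesis by (simp only:)
  qed
  have "w * q dvd x * M k - x ^ k * B k \<and> w * q dvd x * M (Suc k) - x ^ Suc k * B (Suc k)"
  proof (induction k)
    case 0
    show ?case by (simp add: M_def B_def tau_seq_1[OF m])
  next
    case (Suc k)
    then show ?case using step by blast
  qed
  then show ?thesis unfolding M_def B_def by blast
qed

lemma geometric_sum_even:
  fixes x :: "'a::comm_ring_1"
  shows "(\<Sum>i<2 * s. x ^ i) = (1 + x) * (\<Sum>i<s. x ^ (2 * i))"
  by (induction s) (simp_all add: algebra_simps)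

lemma geometric_sum_odd:
  fixes x :: "'a::comm_ring_1"
  shows "(\<Sum>i<2 * s + 1. x ^ i) = (\<Sum>i<Suc s. x ^ (2 * i)) + x * (\<Sum>i<s. x ^ (2 * i))"
  using geometric_sum_even[of x s] by (simp add: algebra_simps)

text \<open>
  The cofactor of \<open>w\<close> in \<open>x\<^sup>n - 1\<close>, that is, the norm element of the group ring.
\<close>

definition geo_sum :: "nat \<Rightarrow> int poly" where
  "geo_sum n = (\<Sum>i<n. [:1, 1:] ^ i)"

lemma cyc_mod_eq: "cyc_mod n = [:0, 1:] * geo_sum n"
proof -
  define x :: "int poly" where "x = [:1, 1:]"
  have "[:0, 1:] = x - 1" by (simp add: x_def one_pCons del: pCons_one)
  moreover have "(x - 1) * (\<Sum>i<n. x ^ i) = x ^ n - 1" by (rule power_diff_1_eq[symmetric])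
  ultimately show ?thesis by (simp add: cyc_mod_def geo_sum_def x_def)
qed

text \<open>
  Modulo \<open>w * quad m\<close> this polynomial represents \<open>x + 1/x - 2\<close>, the negative of the Laplacian
  of the cycle.
\<close>

definition y_poly :: "nat \<Rightarrow> int poly" where
  "y_poly m = [:0, - int m, 1:]"

lemma poly_relations:
  "[:1, 1:] = 1 + [:0, 1 :: int:]"
  "y_poly m = [:0, 1:]\<^sup>2 - of_nat m * [:0, 1:]"
  "quad m = [:0, 1:]\<^sup>2 - of_nat m * [:0, 1:] - of_nat m"
  by (simp_all add: y_poly_def quad_def power2_eq_square of_nat_poly one_pCons del: pCons_one)

text \<open>
  Modulo \<open>w q\<close>, hence also modulo \<open>q\<close>, the variable \<open>x\<close> is a unit, since \<open>w q\<close> takes the value \<open>-1\<close>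
  at \<open>x = 0\<close>.
\<close>

lemma unit_mod:
  "[:0, 1:] * quad m dvd [:1, 1:] * ([:0, 1:]\<^sup>2 - (of_nat m + 1) * [:0, 1:] + 1) - 1"
proof -
  have "(1 + w) * (w\<^sup>2 - (\<mu> + 1) * w + 1) - 1 = w * (w\<^sup>2 - \<mu> * w - \<mu>)" for w \<mu> :: "int poly"
    by (simp add: algebra_simps power2_eq_square)
  then show ?thesis unfolding poly_relations by (metis dvd_refl)
qed

lemma geo_sum_odd:
  assumes "m > 0"
  shows "[:0, 1:] * quad m dvd [:1, 1:] * geo_sum (2 * s + 1)
    - [:1, 1:] ^ Suc s * (of_nat (2 * s + 1) - of_int (g_seq m (int s)) * y_poly m)"
proof -
  define x w :: "int poly" where "x = 1 + w" and "w = [:0, 1:]"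
  define wq y where "wq = w * quad m" and "y = y_poly m"
  note even = sum_even_powers[OF assms, of w, folded poly_relations(2,3)[of m, folded w_def] x_def,
    folded wq_def y_def]
  have "wq dvd (x * (\<Sum>i<Suc s. x ^ (2 * i)) - x ^ Suc s * (of_nat (Suc s) - of_int (tau_seq m (int (Suc s))) * y))
      + x * (x * (\<Sum>i<s. x ^ (2 * i)) - x ^ s * (of_nat s - of_int (tau_seq m (int s)) * y))"
    by (intro dvd_add even dvd_mult[OF even])
  moreover have "of_int (g_seq m (int s)) =
      (of_int (tau_seq m (int s)) + of_int (tau_seq m (int (Suc s))) :: int poly)"
    by (simp add: g_seq_def add.commute)
  ultimately have "wq dvd x * (\<Sum>i<2 * s + 1. x ^ i)
    - x ^ Suc s * (of_nat (2 * s + 1) - of_int (g_seq m (int s)) * y)"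
    unfolding geometric_sum_odd by (simp add: algebra_simps)
  then show ?thesis
    unfolding geo_sum_def poly_relations(1) wq_def x_def y_def w_def .
qed

lemma geo_sum_even:
  assumes "m > 0"
  shows "[:0, 1:] * quad m dvd [:1, 1:] * geo_sum (2 * s)
    - [:1, 1:] ^ s * ((2 + [:0, 1:]) * (of_nat s - of_int (tau_seq m (int s)) * y_poly m))"
proof -
  define x w :: "int poly" where "x = 1 + w" and "w = [:0, 1:]"
  define wq y where "wq = w * quad m" and "y = y_poly m"
  note even = sum_even_powers[OF assms, of w, folded poly_relations(2,3)[of m, folded w_def] x_def,
    folded wq_def y_def]
  have "wq dvd (1 + x) * (x * (\<Sum>i<s. x ^ (2 * i)) - x ^ s * (of_nat s - of_int (tau_seq m (int s)) * y))"
    by (intro dvd_mult even)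
  moreover have "2 + w = 1 + x" by (simp add: x_def)
  ultimately have "wq dvd x * (\<Sum>i<2 * s. x ^ i)
    - x ^ s * ((2 + w) * (of_nat s - of_int (tau_seq m (int s)) * y))"
    unfolding geometric_sum_even by (simp only: right_diff_distrib ac_simps)
  then show ?thesis
    unfolding geo_sum_def poly_relations(1) wq_def x_def y_def w_def .
qed

lemma ideal2_geo_sum_odd:
  assumes "m > 0"
  shows "ideal2 ([:0, 1:] * quad m) (geo_sum (2 * s + 1)) =
    ideal2 ([:0, 1:] * quad m) (of_nat (2 * s + 1) - of_int (g_seq m (int s)) * y_poly m)"
  by (rule ideal2_unit_multiple[OF unit_mod, where i = 1 and j = "Suc s"])
    (simp only: power_one_right geo_sum_odd[OF assms])

lemma ideal2_geo_sum_even: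
  assumes "m > 0"
  shows "ideal2 ([:0, 1:] * quad m) (geo_sum (2 * s)) =
    ideal2 ([:0, 1:] * quad m) ((2 + [:0, 1:]) * (of_nat s - of_int (tau_seq m (int s)) * y_poly m))"
  by (rule ideal2_unit_multiple[OF unit_mod, where i = 1 and j = s])
    (simp only: power_one_right geo_sum_even[OF assms])

text \<open>
  Multiplying the congruence for the geometric sum by \<open>w\<close> gives one for \<open>x\<^sup>n - 1\<close>; modulo \<open>q\<close> alone,
  \<open>y\<close> becomes the integer \<open>m\<close>.
\<close>

lemma ideal2_cyc_mod:
  assumes "[:0, 1:] * quad m dvd [:1, 1:] * geo_sum n - [:1, 1:] ^ j * (e * (a - b * y_poly m))"
  shows "ideal2 (quad m) (cyc_mod n) = ideal2 (quad m) ((a - b * of_nat m) * ([:0, 1:] * e))"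
proof -
  define w x :: "int poly" where "w = [:0, 1:]" and "x = [:1, 1:]"
  have d: "quad m dvd x * geo_sum n - x ^ j * (e * (a - b * y_poly m))"
    using assms unfolding w_def[symmetric] x_def[symmetric] by (rule dvd_mult_right)
  have y: "y_poly m = quad m + of_nat m" unfolding poly_relations by simp
  have "quad m dvd w * (x * geo_sum n - x ^ j * (e * (a - b * y_poly m)))
      - quad m * (x ^ j * w * e * b)"
    by (rule dvd_diff[OF dvd_mult[OF d] dvd_triv_left])
  moreover have "w * (x * geo_sum n - x ^ j * (e * (a - b * y_poly m))) - quad m * (x ^ j * w * e * b)
      = x ^ 1 * cyc_mod n - x ^ j * ((a - b * of_nat m) * (w * e))"
    unfolding y cyc_mod_eq w_def[symmetric] by (simp add: algebra_simps)
  ultimately have "quad m dvd x ^ 1 * cyc_mod n - x ^ j * ((a - b * of_nat m) * (w * e))" by (simp only:)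
  then show ?thesis
    unfolding w_def x_def by (rule ideal2_unit_multiple[OF dvd_mult_right[OF unit_mod]])
qed

lemma ideal2_cyc_mod_odd:
  assumes "m > 0"
  shows "ideal2 (quad m) (cyc_mod (2 * s + 1)) = ideal2 (quad m) (of_int (h_seq m (int s)) * [:0, 1:])"
proof -
  have "h_seq m (int s) = int (2 * s + 1) - g_seq m (int s) * int m"
    using m_times_tau_seq[OF assms, of "int s"] m_times_tau_seq[OF assms, of "int s + 1"]
    by (simp add: h_seq_def g_seq_def algebra_simps)
  then have "of_int (h_seq m (int s)) =
      (of_nat (2 * s + 1) - of_int (g_seq m (int s)) * of_nat m :: int poly)" by simp
  then show ?thesis
    using ideal2_cyc_mod[where e = 1, of m "2 * s + 1" "Suc s"] geo_sum_odd[OF assms, of s] by simp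
qed

lemma ideal2_cyc_mod_even:
  assumes "m > 0"
  shows "ideal2 (quad m) (cyc_mod (2 * s)) =
    ideal2 (quad m) (of_int (u_seq m (int s)) * ([:0, 1:] * (2 + [:0, 1:])))"
proof -
  have "u_seq m (int s) = int s - tau_seq m (int s) * int m"
    using m_times_tau_seq[OF assms, of "int s"] by (simp add: algebra_simps)
  then have "of_int (u_seq m (int s)) =
      (of_nat s - of_int (tau_seq m (int s)) * of_nat m :: int poly)" by simp
  then show ?thesis
    using ideal2_cyc_mod[OF geo_sum_even[OF assms, of s]] by (simp only:)
qed

section \<open>The repeated summand\<close>

lemma add_subgroup_Times: "add_subgroup I \<Longrightarrow> add_subgroup J \<Longrightarrow> add_subgroup (I \<times> J)"
  by (auto simp: add_subgroup_def zero_prod_def)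

lemma quot_cyclic_Times:
  assumes "quot_cyclic I ks" "quot_cyclic J ls" "add_subgroup I" "add_subgroup J"
  shows "quot_cyclic (I \<times> J) (ks @ ls)"
proof (rule quot_cyclic_join[OF assms, where \<theta> = fst and \<eta> = snd])
  show "\<exists>x. fst x - a \<in> I \<and> snd x - b \<in> J" for a b
    using assms(3,4) by (intro exI[of _ "(a, b)"]) (simp add: add_subgroup_def)
qed auto

text \<open>
  In applications \<open>N l\<close> is the remainder of \<open>b * l\<close>, written out in the coefficients of \<open>l\<close>.
\<close>

lemma quot_cyclic_normal_form:
  fixes g :: "int poly" and \<rho> :: "int poly \<Rightarrow> 'b::ab_group_add"
  assumes g: "lead_coeff g = 1" "degree g > 0"
    and Q: "quot_cyclic \<Lambda> ks" "add_subgroup \<Lambda>"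
    and \<rho>: "\<And>p p'. \<rho> (p + p') = \<rho> p + \<rho> p'" "\<And>z. \<exists>r. degree r < degree g \<and> \<rho> r = z"
    and N: "\<And>l. degree l < degree g \<Longrightarrow> degree (N l) < degree g \<and> g dvd b * l - N l"
    and iff: "\<And>r. degree r < degree g \<Longrightarrow>
      (\<exists>l. degree l < degree g \<and> r = N l) \<longleftrightarrow> \<rho> r \<in> \<Lambda>"
  shows "quot_cyclic (ideal2 g b) ks"
proof (rule quot_cyclic_remainder[OF g Q \<rho>])
  fix r :: "int poly" assume r: "degree r < degree g"
  have "g dvd r - b * l \<longleftrightarrow> r = N l" if l: "degree l < degree g" for l
  proof
    assume "g dvd r - b * l"
    then have "g dvd (r - b * l) + (b * l - N l)" using N[OF l] by (intro dvd_add) auto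
    then have "r - N l = 0"
      using r N[OF l] by (intro monic_dvd_small[of g]) (auto intro: degree_diff_less)
    then show "r = N l" by simp
  next
    assume "r = N l"
    then show "g dvd r - b * l" using N[OF l] by (metis dvd_minus_iff minus_diff_eq)
  qed
  then show "(\<exists>l. degree l < degree g \<and> g dvd r - b * l) \<longleftrightarrow> \<rho> r \<in> \<Lambda>"
    using iff[OF r] by auto
qed

lemma degree_less_2_iff: "degree p < 2 \<longleftrightarrow> (\<exists>a b. p = [:a, b:])"
proof
  assume p: "degree p < 2"
  have "p = [:coeff p 0, coeff p 1:]"
    using p by (intro poly_eqI) (auto simp: coeff_pCons coeff_eq_0 split: nat.split)
  then show "\<exists>a b. p = [:a, b:]" by blast
qed (auto simp: less_Suc_eq_le numeral_2_eq_2)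

lemma degree_less_3_iff: "degree p < 3 \<longleftrightarrow> (\<exists>a b c. p = [:a, b, c:])"
proof
  assume p: "degree p < 3"
  have "p = [:coeff p 0, coeff p 1, coeff p 2:]"
    using p by (intro poly_eqI) (auto simp: coeff_pCons coeff_eq_0 numeral_2_eq_2 split: nat.split)
  then show "\<exists>a b c. p = [:a, b, c:]" by blast
qed (auto simp: less_Suc_eq_le numeral_3_eq_3)

lemma quot_cyclic_quad:
  assumes Q: "quot_cyclic \<Lambda> ks" "add_subgroup \<Lambda>"
    and N: "\<And>l0 l1. quad m dvd b * [:l0, l1:] - [:A l0 l1, B l0 l1:]"
    and iff: "\<And>c0 c1. (\<exists>l0 l1. c0 = A l0 l1 \<and> c1 = B l0 l1) \<longleftrightarrow> (c0, c1) \<in> \<Lambda>"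
  shows "quot_cyclic (ideal2 (quad m) b) ks"
proof (rule quot_cyclic_normal_form[where \<rho> = "\<lambda>p. (coeff p 0, coeff p 1)"
      and N = "\<lambda>l. [:A (coeff l 0) (coeff l 1), B (coeff l 0) (coeff l 1):]", OF _ _ Q])
  have deg: "degree (quad m) = 2" by (simp add: quad_def)
  show "lead_coeff (quad m) = 1" "degree (quad m) > 0" by (simp_all add: quad_def)
  show "\<exists>r. degree r < degree (quad m) \<and> (coeff r 0, coeff r 1) = z" for z :: "int \<times> int"
    unfolding deg degree_less_2_iff by (intro exI[of _ "[:fst z, snd z:]"]) auto
  show "degree [:A (coeff l 0) (coeff l 1), B (coeff l 0) (coeff l 1):] < degree (quad m) \<and>
      quad m dvd b * l - [:A (coeff l 0) (coeff l 1), B (coeff l 0) (coeff l 1):]"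
    if "degree l < degree (quad m)" for l
    using that N unfolding deg degree_less_2_iff by auto
  show "(\<exists>l. degree l < degree (quad m) \<and>
        r = [:A (coeff l 0) (coeff l 1), B (coeff l 0) (coeff l 1):]) \<longleftrightarrow>
      (coeff r 0, coeff r 1) \<in> \<Lambda>" if d: "degree r < degree (quad m)" for r
  proof -
    obtain c0 c1 where r: "r = [:c0, c1:]" using d unfolding deg degree_less_2_iff by blast
    have "(\<exists>l. degree l < degree (quad m) \<and>
          r = [:A (coeff l 0) (coeff l 1), B (coeff l 0) (coeff l 1):]) \<longleftrightarrow>
        (\<exists>l0 l1. r = [:A (coeff [:l0, l1:] 0) (coeff [:l0, l1:] 1),
          B (coeff [:l0, l1:] 0) (coeff [:l0, l1:] 1):])"
      unfolding deg degree_less_2_iff by blast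
    then show ?thesis unfolding r using iff by simp
  qed
qed simp

lemma quot_cyclic_cubic:
  assumes Q: "quot_cyclic \<Lambda> ks" "add_subgroup \<Lambda>"
    and \<rho>: "\<And>p p'. \<rho> (p + p') = \<rho> p + \<rho> p'" "\<And>z. \<exists>c0 c1 c2. \<rho> [:c0, c1, c2:] = z"
    and N: "\<And>l0 l1 l2. [:0, 1:] * quad m dvd
      b * [:l0, l1, l2:] - [:A l0 l1 l2, B l0 l1 l2, C l0 l1 l2:]"
    and iff: "\<And>c0 c1 c2. (\<exists>l0 l1 l2. c0 = A l0 l1 l2 \<and> c1 = B l0 l1 l2 \<and> c2 = C l0 l1 l2)
      \<longleftrightarrow> \<rho> [:c0, c1, c2:] \<in> \<Lambda>"
  shows "quot_cyclic (ideal2 ([:0, 1:] * quad m) b) ks"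
proof (rule quot_cyclic_normal_form[where \<rho> = \<rho>
      and N = "\<lambda>l. [:A (coeff l 0) (coeff l 1) (coeff l 2), B (coeff l 0) (coeff l 1) (coeff l 2),
        C (coeff l 0) (coeff l 1) (coeff l 2):]", OF _ _ Q \<rho>(1)])
  let ?g = "[:0, 1:] * quad m"
  let ?N = "\<lambda>l. [:A (coeff l 0) (coeff l 1) (coeff l 2), B (coeff l 0) (coeff l 1) (coeff l 2),
        C (coeff l 0) (coeff l 1) (coeff l 2):]"
  have deg: "degree ?g = 3" by (simp add: quad_def)
  show "lead_coeff ?g = 1" "degree ?g > 0" by (simp_all add: quad_def)
  show "\<exists>r. degree r < degree ?g \<and> \<rho> r = z" for z
    using \<rho>(2)[of z] unfolding deg degree_less_3_iff by blast
  show "degree (?N l) < degree ?g \<and> ?g dvd b * l - ?N l" if l: "degree l < degree ?g" for l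
  proof -
    obtain l0 l1 l2 where "l = [:l0, l1, l2:]" using l unfolding deg degree_less_3_iff by blast
    then show ?thesis using N[of l0 l1 l2] unfolding deg degree_less_3_iff
      by (simp add: numeral_2_eq_2)
  qed
  show "(\<exists>l. degree l < degree ?g \<and> r = ?N l) \<longleftrightarrow> \<rho> r \<in> \<Lambda>" if d: "degree r < degree ?g" for r
  proof -
    obtain c0 c1 c2 where r: "r = [:c0, c1, c2:]" using d unfolding deg degree_less_3_iff by blast
    have "(\<exists>l. degree l < degree ?g \<and> r = ?N l) \<longleftrightarrow>
        (\<exists>l0 l1 l2. r = ?N [:l0, l1, l2:])" unfolding deg degree_less_3_iff by blast
    then show ?thesis unfolding r iff[symmetric] by (simp add: numeral_2_eq_2)
  qed
qed

text \<open>
  Modulo \<open>q\<close> one has \<open>w\<^sup>2 = m (w + 1)\<close>, so the multiples of \<open>h w\<close> form the lattice spanned by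
  \<open>h w\<close> and \<open>h m\<close>.
\<close>

lemma quot_cyclic_quad_odd:
  fixes m s :: nat
  assumes m: "m > 0"
  defines "h \<equiv> h_seq m (int s)"
  shows "quot_cyclic (ideal2 (quad m) (cyc_mod (2 * s + 1))) [int m * h, h]"
  unfolding ideal2_cyc_mod_odd[OF m] h_def[symmetric]
proof -
  have "quot_cyclic ({x. int m * h dvd x} \<times> {x. h dvd x}) ([int m * h] @ [h])"
    by (intro quot_cyclic_Times quot_cyclic_int add_subgroup_multiples)
  then have "quot_cyclic (ideal2 (quad m) (of_int h * [:0, 1:])) ([int m * h] @ [h])"
  proof (rule quot_cyclic_quad[OF _ add_subgroup_Times[OF add_subgroup_multiples add_subgroup_multiples],
        where A = "\<lambda>l0 l1. int m * h * l1" and B = "\<lambda>l0 l1. h * (l0 + int m * l1)"])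
    show "quad m dvd of_int h * [:0, 1:] * [:l0, l1:] - [:int m * h * l1, h * (l0 + int m * l1):]" for l0 l1
      by (rule dvdI[of _ _ "[:h * l1:]"]) (simp add: quad_def of_int_poly algebra_simps)
    show "(\<exists>l0 l1. c0 = int m * h * l1 \<and> c1 = h * (l0 + int m * l1)) \<longleftrightarrow>
        (c0, c1) \<in> {x. int m * h dvd x} \<times> {x. h dvd x}" for c0 c1
    proof
      assume "(c0, c1) \<in> {x. int m * h dvd x} \<times> {x. h dvd x}"
      then obtain a b where "c0 = int m * h * a" "c1 = h * b" by (auto elim!: dvdE)
      then show "\<exists>l0 l1. c0 = int m * h * l1 \<and> c1 = h * (l0 + int m * l1)"
        by (intro exI[of _ "b - int m * a"] exI[of _ a]) simp
    qed auto
  qed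
  then show "quot_cyclic (ideal2 (quad m) (of_int h * [:0, 1:])) [int m * h, h]" by simp
qed

lemma gcd_m_2_dvd: "gcd (int m) 2 dvd int m + 4"
  by (intro dvd_add gcd_dvd1) (auto intro: dvd_trans[of _ 2])

text \<open>
  Here \<open>x\<^sup>n - 1\<close> is a unit times \<open>u w (w + 2)\<close>. Its multiples by 1 and \<open>w\<close> are
  \<open>u (m + (m + 2) w)\<close> and \<open>u (m (m + 2) + m (m + 3) w)\<close>. Subtracting \<open>m + 2\<close> times the first from
  the second leaves \<open>- u (m + 4) w\<close>, a triangular lattice.
\<close>

lemma quot_cyclic_quad_even:
  fixes m s :: nat
  assumes m: "m > 0" and s: "s > 0"
  defines "u \<equiv> u_seq m (int s)"
  shows "quot_cyclic (ideal2 (quad m) (cyc_mod (2 * s)))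
    [gcd (int m) 2 * u, int m * (int m + 4) * u div gcd (int m) 2]"
proof -
  have u: "u > 0" unfolding u_def using u_seq_pos[OF m s] .
  have "gcd (u * int m) (u * (int m + 2)) = u * gcd (int m) (int m + 2)"
    using u by (simp add: gcd_mult_distrib_int[symmetric])
  also have "gcd (int m) (int m + 2) = gcd (int m) 2" by (simp add: gcd_add2)
  finally have gcd: "gcd (u * int m) (u * (int m + 2)) = gcd (int m) 2 * u" by (simp add: mult.commute)
  have quo: "(u * int m) * (u * (int m + 4)) div (gcd (int m) 2 * u)
      = int m * (int m + 4) * u div gcd (int m) 2"
  proof -
    have "(u * int m) * (u * (int m + 4)) = (int m * (int m + 4) * u) * u" by (simp add: ac_simps)
    then show ?thesis using u by (simp add: ac_simps)
  qed
  have dvd: "gcd (int m) 2 * u dvd u * (int m + 4)"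
    using gcd_m_2_dvd[of m] by (simp add: mult.commute mult_dvd_mono)
  have "quot_cyclic (triangular_lattice (u * int m) (u * (int m + 2)) (u * (int m + 4)))
    [gcd (int m) 2 * u, int m * (int m + 4) * u div gcd (int m) 2]"
    using quot_cyclic_triangular[of "u * int m" "u * (int m + 2)" "u * (int m + 4)"] dvd u m
    unfolding gcd quo by simp
  then show ?thesis
    unfolding ideal2_cyc_mod_even[OF m] u_def[symmetric]
  proof (rule quot_cyclic_quad[OF _ add_subgroup_triangular,
        where A = "\<lambda>l0 l1. u * int m * (l0 + (int m + 2) * l1)"
          and B = "\<lambda>l0 l1. u * (int m + 2) * (l0 + (int m + 2) * l1) - u * (int m + 4) * l1"])
    show "quad m dvd of_int u * ([:0, 1:] * (2 + [:0, 1:])) * [:l0, l1:]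
        - [:u * int m * (l0 + (int m + 2) * l1),
           u * (int m + 2) * (l0 + (int m + 2) * l1) - u * (int m + 4) * l1:]" for l0 l1
      by (rule dvdI[of _ _ "[:u * (l0 + (int m + 2) * l1), u * l1:]"])
        (simp add: quad_def of_int_poly numeral_poly algebra_simps)
    show "(\<exists>l0 l1. c0 = u * int m * (l0 + (int m + 2) * l1) \<and>
          c1 = u * (int m + 2) * (l0 + (int m + 2) * l1) - u * (int m + 4) * l1) \<longleftrightarrow>
        (c0, c1) \<in> triangular_lattice (u * int m) (u * (int m + 2)) (u * (int m + 4))" for c0 c1
    proof
      assume "(c0, c1) \<in> triangular_lattice (u * int m) (u * (int m + 2)) (u * (int m + 4))"
      then obtain k l where "c0 = u * int m * k" "c1 = u * (int m + 2) * k + u * (int m + 4) * l"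
        unfolding triangular_lattice_def by blast
      then show "\<exists>l0 l1. c0 = u * int m * (l0 + (int m + 2) * l1) \<and>
          c1 = u * (int m + 2) * (l0 + (int m + 2) * l1) - u * (int m + 4) * l1"
        by (intro exI[of _ "k + (int m + 2) * l"] exI[of _ "- l"]) (simp add: algebra_simps)
    next
      assume "\<exists>l0 l1. c0 = u * int m * (l0 + (int m + 2) * l1) \<and>
          c1 = u * (int m + 2) * (l0 + (int m + 2) * l1) - u * (int m + 4) * l1"
      then obtain l0 l1 where "c0 = u * int m * (l0 + (int m + 2) * l1)"
          "c1 = u * (int m + 2) * (l0 + (int m + 2) * l1) + u * (int m + 4) * (- l1)" by auto
      then show "(c0, c1) \<in> triangular_lattice (u * int m) (u * (int m + 2)) (u * (int m + 4))"
        unfolding triangular_lattice_def by blast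
    qed
  qed
qed

section \<open>The exceptional summand\<close>

text \<open>
  The free summand is the constant coefficient, the value at \<open>x = 1\<close>. Polynomials without constant
  term are multiples of \<open>w\<close>, and one factor \<open>w\<close> cancels from both generators of the ideal.
\<close>

lemma quot_cyclic_split_augmentation:
  assumes "quot_cyclic (ideal2 ([:0, 1:] * quad m) (geo_sum n)) ks"
  shows "quot_cyclic (ideal2 ([:0, 1:]\<^sup>2 * quad m) (cyc_mod n)) (0 # ks)"
proof -
  let ?J = "ideal2 ([:0, 1:] * quad m) (geo_sum n)"
  have split: "p = pCons (coeff p 0) (poly_shift 1 p)" for p :: "int poly"
    by (simp add: poly_eq_iff coeff_pCons coeff_poly_shift split: nat.split)
  have shift: "poly_shift 1 (pCons a p) = p" for a and p :: "int poly"
    by (simp add: poly_eq_iff coeff_poly_shift)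
  have "quot_cyclic (ideal2 ([:0, 1:]\<^sup>2 * quad m) (cyc_mod n)) ([0] @ ks)"
  proof (rule quot_cyclic_join[OF quot_cyclic_int assms add_subgroup_multiples add_subgroup_ideal2,
        where \<theta> = "\<lambda>p. coeff p 0" and \<eta> = "poly_shift 1"])
    show "poly_shift 1 (p + p') = poly_shift 1 p + poly_shift 1 p'" for p p' :: "int poly"
      by (simp add: poly_eq_iff coeff_poly_shift)
    show "\<exists>p. coeff p 0 - a \<in> {x. 0 dvd x} \<and> poly_shift 1 p - b \<in> ?J" for a b
    proof (intro exI conjI)
      show "coeff (pCons a b) 0 - a \<in> {x. 0 dvd x}" by simp
      show "poly_shift 1 (pCons a b) - b \<in> ?J"
        unfolding shift using add_subgroup_ideal2[of "[:0, 1:] * quad m" "geo_sum n"]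
        by (simp add: add_subgroup_def)
    qed
    show "p \<in> ideal2 ([:0, 1:]\<^sup>2 * quad m) (cyc_mod n) \<longleftrightarrow>
        coeff p 0 \<in> {x. 0 dvd x} \<and> poly_shift 1 p \<in> ?J" for p
    proof -
      have w: "[:0, 1:] * r = pCons 0 r" for r :: "int poly" by simp
      have "p \<in> ideal2 ([:0, 1:]\<^sup>2 * quad m) (cyc_mod n) \<longleftrightarrow>
          (\<exists>k l. p = [:0, 1:] * ([:0, 1:] * quad m * k + geo_sum n * l))"
        unfolding ideal2_def cyc_mod_eq by (simp only: power2_eq_square distrib_left mult.assoc mem_Collect_eq simp_thms)
      also have "\<dots> \<longleftrightarrow> (\<exists>r\<in>?J. p = pCons 0 r)"
        unfolding w unfolding ideal2_def by blast
      also have "\<dots> \<longleftrightarrow> coeff p 0 = 0 \<and> poly_shift 1 p \<in> ?J"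
        using split[of p] shift by (metis coeff_pCons_0)
      finally show ?thesis by simp
    qed
  qed simp
  then show ?thesis by simp
qed

text \<open>
  In the basis \<open>1, w, y\<close> modulo \<open>w q\<close>, where \<open>w y = m w\<close> and \<open>y\<^sup>2 = m y\<close>, multiplication by
  \<open>n - g y\<close> sends \<open>1\<close> to \<open>n - g y\<close>, and \<open>w\<close>, \<open>y\<close> to \<open>h w\<close>, \<open>h y\<close>. So \<open>w\<close> splits off and a triangular lattice
  on \<open>1\<close> and \<open>y\<close> remains.
\<close>

lemma quot_cyclic_geo_sum_odd:
  fixes m s :: nat
  assumes m: "m > 0"
  defines "h \<equiv> h_seq m (int s)" and "g \<equiv> g_seq m (int s)" and "n \<equiv> 2 * s + 1"
  shows "quot_cyclic (ideal2 ([:0, 1:] * quad m) (geo_sum n))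
    [h, gcd (int n) g, int n * h div gcd (int n) g]"
proof -
  have h: "h = int n - int m * g"
    using m_times_tau_seq[OF m, of "int s"] m_times_tau_seq[OF m, of "int s + 1"]
    by (simp add: h_def g_def n_def h_seq_def g_seq_def algebra_simps)
  have "gcd (int n) g dvd h" unfolding h by simp
  then have T: "quot_cyclic (triangular_lattice (int n) (- g) h)
      [gcd (int n) g, int n * h div gcd (int n) g]"
    using quot_cyclic_triangular[of "int n" "- g" h] by (simp add: n_def)
  have \<nu>: "of_nat n - of_int g * y_poly m = [:int n, int m * g, - g:]"
    by (simp add: y_poly_def of_nat_poly of_int_poly)
  let ?\<Lambda> = "{x. h dvd x} \<times> triangular_lattice (int n) (- g) h"
  have "quot_cyclic ?\<Lambda> ([h] @ [gcd (int n) g, int n * h div gcd (int n) g])"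
    by (intro quot_cyclic_Times quot_cyclic_int T add_subgroup_multiples add_subgroup_triangular)
  then have "quot_cyclic (ideal2 ([:0, 1:] * quad m) [:int n, int m * g, - g:])
      ([h] @ [gcd (int n) g, int n * h div gcd (int n) g])"
  proof (rule quot_cyclic_cubic[
        where \<rho> = "\<lambda>p. (coeff p 1 + int m * coeff p 2, coeff p 0, coeff p 2)"
          and A = "\<lambda>l0 l1 l2. int n * l0" and B = "\<lambda>l0 l1 l2. int m * g * l0 + h * l1"
          and C = "\<lambda>l0 l1 l2. - g * l0 + h * l2"])
    show "add_subgroup ?\<Lambda>"
      by (intro add_subgroup_Times add_subgroup_multiples add_subgroup_triangular)
    show "\<exists>c0 c1 c2. (coeff [:c0, c1, c2:] 1 + int m * coeff [:c0, c1, c2:] 2,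
        coeff [:c0, c1, c2:] 0, coeff [:c0, c1, c2:] 2) = z" for z :: "int \<times> int \<times> int"
      by (cases z, intro exI[of _ "fst (snd z)"] exI[of _ "fst z - int m * snd (snd z)"]
          exI[of _ "snd (snd z)"]) (simp add: numeral_2_eq_2)
    show "[:0, 1:] * quad m dvd [:int n, int m * g, - g:] * [:l0, l1, l2:]
        - [:int n * l0, int m * g * l0 + h * l1, - g * l0 + h * l2:]" for l0 l1 l2
      \<comment> \<open>By \<open>w * y = m * w + w * q\<close>, multiplication by \<open>n - g y\<close> takes \<open>w\<close> to \<open>h w - g w q\<close>.\<close>
      by (rule dvdI[of _ _ "[:- g * l1, - g * l2:]"]) (simp add: quad_def h algebra_simps)
    show "(\<exists>l0 l1 l2. c0 = int n * l0 \<and> c1 = int m * g * l0 + h * l1 \<and> c2 = - g * l0 + h * l2) \<longleftrightarrow>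
        (coeff [:c0, c1, c2:] 1 + int m * coeff [:c0, c1, c2:] 2,
         coeff [:c0, c1, c2:] 0, coeff [:c0, c1, c2:] 2) \<in> ?\<Lambda>" for c0 c1 c2
    proof -
      have "(\<exists>l0 l1 l2. c0 = int n * l0 \<and> c1 = int m * g * l0 + h * l1 \<and> c2 = - g * l0 + h * l2) \<longleftrightarrow>
          h dvd c1 + int m * c2 \<and> (c0, c2) \<in> triangular_lattice (int n) (- g) h"
      proof
        assume "\<exists>l0 l1 l2. c0 = int n * l0 \<and> c1 = int m * g * l0 + h * l1 \<and> c2 = - g * l0 + h * l2"
        then obtain l0 l1 l2 where c: "c0 = int n * l0" "c1 = int m * g * l0 + h * l1"
          "c2 = - g * l0 + h * l2" by blast
        have "c1 + int m * c2 = h * (l1 + int m * l2)" unfolding c by (simp add: algebra_simps)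
        then show "h dvd c1 + int m * c2 \<and> (c0, c2) \<in> triangular_lattice (int n) (- g) h"
          unfolding triangular_lattice_def using c(1,3) by auto
      next
        assume R: "h dvd c1 + int m * c2 \<and> (c0, c2) \<in> triangular_lattice (int n) (- g) h"
        then obtain j where j: "c1 + int m * c2 = h * j" by (auto elim: dvdE)
        obtain k l where c: "c0 = int n * k" "c2 = - g * k + h * l"
          using R unfolding triangular_lattice_def by blast
        have "c1 = int m * g * k + h * (j - int m * l)"
          using j unfolding c(2) by (simp add: algebra_simps)
        then show "\<exists>l0 l1 l2. c0 = int n * l0 \<and> c1 = int m * g * l0 + h * l1 \<and> c2 = - g * l0 + h * l2"
          using c by blast
      qed
      then show ?thesis by (simp add: numeral_2_eq_2)
    qed
  qed (simp add: algebra_simps)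
  then show ?thesis
    unfolding n_def ideal2_geo_sum_odd[OF m] \<nu>[unfolded g_def n_def] g_def h_def by simp
qed

text \<open>
  In the basis \<open>x = w + 1\<close>, \<open>w\<close>, \<open>z = w\<^sup>2 + 2 w\<close> modulo \<open>w q\<close> the relations become
  \<open>n x = (u - 4 \<tau>) w + 2 \<tau> z\<close>, \<open>(m + 4) u w = 0\<close> and \<open>u z = 0\<close>. The divisibilities required by
  \<open>quot_cyclic_triangular3\<close> all come from \<open>n = 2 u + 2 m \<tau>\<close>.
\<close>

lemma quot_cyclic_geo_sum_even:
  fixes m s :: nat
  assumes m: "m > 0" and s: "s > 0"
  defines "u \<equiv> u_seq m (int s)" and "\<tau> \<equiv> tau_seq m (int s)" and "n \<equiv> 2 * int s"
  defines "t \<equiv> gcd u (2 * \<tau>)" and "d \<equiv> gcd n (u - 4 * \<tau>)"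
  shows "quot_cyclic (ideal2 ([:0, 1:] * quad m) (geo_sum (2 * s)))
    [u * d div t, n * (int m + 4) * u div d, t]"
proof -
  have u: "u > 0" unfolding u_def using u_seq_pos[OF m s] .
  have n: "n > 0" using s by (simp add: n_def)
  have s_eq: "int s = u + int m * \<tau>"
    using m_times_tau_seq[OF m, of "int s"] by (simp add: u_def \<tau>_def)
  have t: "t > 0" "t dvd u" "t dvd 2 * \<tau>" using u by (simp_all add: t_def)
  have d: "d > 0" "d dvd n" "d dvd u - 4 * \<tau>" using n by (simp_all add: d_def)
  obtain f where f: "u = t * f" using t(2) by (rule dvdE)
  have f0: "f > 0" using u t(1) unfolding f by (simp add: zero_less_mult_iff)
  define K where "K = t * (int m + 4)"
  have dK: "d dvd K"
  proof -
    have *: "(int m + 4) * u = int m * (u - 4 * \<tau>) + 2 * n"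
      "(int m + 4) * (2 * \<tau>) = n - 2 * (u - 4 * \<tau>)"
      unfolding n_def s_eq by (simp_all add: algebra_simps)
    have "d dvd (int m + 4) * u" "d dvd (int m + 4) * (2 * \<tau>)"
      unfolding * by (intro dvd_add dvd_diff d(2) d(3) dvd_mult)+
    then have "d dvd gcd ((int m + 4) * u) ((int m + 4) * (2 * \<tau>))" by (rule gcd_greatest)
    also have "gcd ((int m + 4) * u) ((int m + 4) * (2 * \<tau>)) = \<bar>int m + 4\<bar> * t"
      unfolding t_def by (rule gcd_mult_distrib_int[symmetric])
    also have "\<dots> = K" unfolding K_def by simp
    finally show ?thesis .
  qed
  have td: "t dvd n" "t dvd u - 4 * \<tau>"
  proof -
    have *: "n = 2 * u + int m * (2 * \<tau>)" "u - 4 * \<tau> = u - 2 * (2 * \<tau>)"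
      unfolding n_def s_eq by (simp_all add: algebra_simps)
    show "t dvd n" "t dvd u - 4 * \<tau>"
      unfolding * by (intro dvd_add dvd_diff t(2) t(3) dvd_mult)+
  qed
  have g: "gcd (f * n) (f * (- (u - 4 * \<tau>))) = f * d"
    using f0 by (simp add: gcd_mult_distrib_int[symmetric] d_def gcd_neg2_int del: minus_diff_eq)
  have fd: "f * d = u * d div t" unfolding f using t(1) by simp
  have quo: "(f * n) * (f * K) div (f * d) = n * (int m + 4) * u div d"
  proof -
    have fK: "(f * n) * (f * K) = f * (n * (int m + 4) * u)" unfolding K_def f by (simp add: ac_simps)
    show ?thesis unfolding fK using f0 by simp
  qed
  have "quot_cyclic (triangular_lattice3 n (- (u - 4 * \<tau>)) (- 2 * \<tau>) (f * K) u)
      [gcd (f * n) (f * (- (u - 4 * \<tau>))),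
        (f * n) * (f * K) div gcd (f * n) (f * (- (u - 4 * \<tau>))), t]"
  proof (rule quot_cyclic_triangular3[OF _ _ _ td(1) _ f refl])
    show "n \<noteq> 0" "f \<noteq> 0" using n f0 by simp_all
    show "t = gcd u (- 2 * \<tau>)" by (simp add: t_def)
    show "t dvd - (u - 4 * \<tau>)" using td(2) by (simp only: dvd_minus_iff)
    show "gcd n (- (u - 4 * \<tau>)) dvd K" using dK unfolding d_def gcd_neg2_int .
  qed
  then have "quot_cyclic (triangular_lattice3 n (- (u - 4 * \<tau>)) (- 2 * \<tau>) (f * K) u)
      [u * d div t, n * (int m + 4) * u div d, t]"
    unfolding g quo unfolding fd .
  moreover have "f * K = (int m + 4) * u" unfolding K_def f by simp
  ultimately have T: "quot_cyclic (triangular_lattice3 n (- (u - 4 * \<tau>)) (- 2 * \<tau>) ((int m + 4) * u) u)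
      [u * d div t, n * (int m + 4) * u div d, t]" (is "quot_cyclic ?\<Lambda> _") by simp
  have \<nu>: "(2 + [:0, 1:]) * (of_nat s - of_int \<tau> * y_poly m) =
      (2 + [:0, 1:]) * [:int s, int m * \<tau>, - \<tau>:]"
    by (simp add: y_poly_def of_nat_poly of_int_poly)
  have "quot_cyclic (ideal2 ([:0, 1:] * quad m) ((2 + [:0, 1:]) * [:int s, int m * \<tau>, - \<tau>:]))
      [u * d div t, n * (int m + 4) * u div d, t]"
  proof (rule quot_cyclic_cubic[OF T add_subgroup_triangular3,
        where \<rho> = "\<lambda>p. ((coeff p 0, coeff p 1 - coeff p 0 - 2 * coeff p 2), coeff p 2)"
          and A = "\<lambda>l0 l1 l2. n * l0"
          and B = "\<lambda>l0 l1 l2. (u + 2 * int m * \<tau>) * l0 + 2 * u * l1 + int m * u * l2"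
          and C = "\<lambda>l0 l1 l2. - 2 * \<tau> * l0 + u * l1 + (int m + 2) * u * l2"])
    show "\<exists>c0 c1 c2. ((coeff [:c0, c1, c2:] 0, coeff [:c0, c1, c2:] 1 - coeff [:c0, c1, c2:] 0
        - 2 * coeff [:c0, c1, c2:] 2), coeff [:c0, c1, c2:] 2) = z" for z :: "(int \<times> int) \<times> int"
      by (cases z, intro exI[of _ "fst (fst z)"] exI[of _ "snd (fst z) + fst (fst z) + 2 * snd z"]
          exI[of _ "snd z"]) (auto simp: numeral_2_eq_2)
    show "[:0, 1:] * quad m dvd (2 + [:0, 1:]) * [:int s, int m * \<tau>, - \<tau>:] * [:l0, l1, l2:]
        - [:n * l0, (u + 2 * int m * \<tau>) * l0 + 2 * u * l1 + int m * u * l2,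
            - 2 * \<tau> * l0 + u * l1 + (int m + 2) * u * l2:]" for l0 l1 l2
      \<comment> \<open>The quotient collects the multiples of \<open>w q\<close> in the images of \<open>1\<close>, \<open>w\<close> and \<open>w\<^sup>2\<close>.\<close>
      by (rule dvdI[of _ _ "[:- \<tau> * l0 - 2 * \<tau> * l1 + u * l2, - \<tau> * l1 - 2 * \<tau> * l2, - \<tau> * l2:]"])
        (simp add: quad_def n_def s_eq numeral_poly algebra_simps)
    show "(\<exists>l0 l1 l2. c0 = n * l0 \<and>
          c1 = (u + 2 * int m * \<tau>) * l0 + 2 * u * l1 + int m * u * l2 \<and>
          c2 = - 2 * \<tau> * l0 + u * l1 + (int m + 2) * u * l2) \<longleftrightarrow>
        ((coeff [:c0, c1, c2:] 0, coeff [:c0, c1, c2:] 1 - coeff [:c0, c1, c2:] 0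
        - 2 * coeff [:c0, c1, c2:] 2), coeff [:c0, c1, c2:] 2) \<in> ?\<Lambda>" for c0 c1 c2
    proof -
      have "(\<exists>l0 l1 l2. c0 = n * l0 \<and>
          c1 = (u + 2 * int m * \<tau>) * l0 + 2 * u * l1 + int m * u * l2 \<and>
          c2 = - 2 * \<tau> * l0 + u * l1 + (int m + 2) * u * l2) \<longleftrightarrow>
        ((c0, c1 - c0 - 2 * c2), c2) \<in> ?\<Lambda>"
      proof
        assume "\<exists>l0 l1 l2. c0 = n * l0 \<and>
          c1 = (u + 2 * int m * \<tau>) * l0 + 2 * u * l1 + int m * u * l2 \<and>
          c2 = - 2 * \<tau> * l0 + u * l1 + (int m + 2) * u * l2"
        then obtain l0 l1 l2 where c: "c0 = n * l0"
          "c1 = (u + 2 * int m * \<tau>) * l0 + 2 * u * l1 + int m * u * l2"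
          "c2 = - 2 * \<tau> * l0 + u * l1 + (int m + 2) * u * l2" by blast
        have "c1 - c0 - 2 * c2 = - (u - 4 * \<tau>) * l0 + (int m + 4) * u * (- l2)"
          "c2 = - 2 * \<tau> * l0 + u * (l1 + (int m + 2) * l2)"
          unfolding c n_def s_eq by (simp_all add: algebra_simps)
        with c(1) show "((c0, c1 - c0 - 2 * c2), c2) \<in> ?\<Lambda>"
          unfolding triangular_lattice3_def by blast
      next
        assume "((c0, c1 - c0 - 2 * c2), c2) \<in> ?\<Lambda>"
        then obtain k l r where c: "c0 = n * k"
          "c1 - c0 - 2 * c2 = - (u - 4 * \<tau>) * k + (int m + 4) * u * l"
          "c2 = - 2 * \<tau> * k + u * r"
          unfolding triangular_lattice3_def by blast
        have "c1 = c0 + 2 * c2 + (- (u - 4 * \<tau>) * k + (int m + 4) * u * l)" using c(2) by simp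
        then have "c1 = (u + 2 * int m * \<tau>) * k + 2 * u * (r + (int m + 2) * l) + int m * u * (- l)"
          "c2 = - 2 * \<tau> * k + u * (r + (int m + 2) * l) + (int m + 2) * u * (- l)"
          unfolding c(1,3) n_def s_eq by (simp_all add: algebra_simps)
        with c(1) show "\<exists>l0 l1 l2. c0 = n * l0 \<and>
          c1 = (u + 2 * int m * \<tau>) * l0 + 2 * u * l1 + int m * u * l2 \<and>
          c2 = - 2 * \<tau> * l0 + u * l1 + (int m + 2) * u * l2" by blast
      qed
      then show ?thesis by (simp add: numeral_2_eq_2)
    qed
  qed (simp add: algebra_simps)
  then show ?thesis
    unfolding ideal2_geo_sum_even[OF m] \<nu>[unfolded \<tau>_def] \<tau>_def by simp
qed

section \<open>Greatest common divisors\<close>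

text \<open>
  Divide \<open>n\<close>, \<open>g\<close> and \<open>h\<close> by \<open>d\<close>: both sides of the first equation reduce to \<open>h\<close> times \<open>gcd m (n / d)\<close>, because
  \<open>n / d\<close> is coprime to \<open>g / d\<close> and \<open>h / d = n / d - m g / d\<close>.
\<close>

lemma gcd_quotients_odd:
  fixes n g m h :: int
  assumes h: "h = n - m * g" "h > 0" and n: "n > 0"
  defines "d \<equiv> gcd n g"
  shows "gcd (m * h) (n * h div d) = (h div d) * gcd n h"
    and "(m * h) * (n * h div d) div gcd (m * h) (n * h div d) = n * m * h div gcd n h"
proof -
  have d: "d > 0" using n by (simp add: d_def)
  obtain n1 g1 where n1: "n = d * n1" and g1: "g = d * g1"
    unfolding d_def by (meson dvdE gcd_dvd1 gcd_dvd2)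
  have "d * gcd n1 g1 = d * 1"
    using gcd_mult_distrib_int[of d n1 g1] d unfolding n1[symmetric] g1[symmetric] d_def[symmetric] by simp
  then have cop: "coprime n1 g1" using d by (simp add: coprime_iff_gcd_eq_1)
  define h1 where "h1 = n1 - m * g1"
  have h1: "h = d * h1" unfolding h(1) h1_def by (subst n1, subst g1) (simp add: algebra_simps)
  define c where "c = gcd m n1"
  have "gcd n1 h1 = gcd n1 (m * g1)" unfolding h1_def
    using gcd_diff2[of n1 "m * g1"] by (simp only: gcd.commute)
  also have "\<dots> = gcd n1 m" by (rule gcd_mult_right_right_cancel[OF cop])
  also have "\<dots> = c" unfolding c_def by (rule gcd.commute)
  finally have c: "gcd n1 h1 = c" .
  have nh: "gcd n h = d * c"
    using gcd_mult_distrib_int[of d n1 h1] d unfolding n1[symmetric] h1[symmetric] c by simp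
  have q: "n * h div d = n1 * h" using d by (subst n1) simp
  have G: "gcd (m * h) (n * h div d) = h * c"
    using gcd_mult_distrib_int[of h m n1] h(2) unfolding q c_def by (simp add: mult.commute)
  have "(h div d) * gcd n h = h1 * (d * c)" unfolding nh using d by (subst h1) simp
  also have "\<dots> = h * c" by (subst h1) simp
  finally show "gcd (m * h) (n * h div d) = (h div d) * gcd n h" unfolding G by simp
  have *: "(m * h) * (n * h div d) = h * (n1 * m * h)" unfolding q by simp
  have "(m * h) * (n * h div d) div gcd (m * h) (n * h div d) = n1 * m * h div c"
    unfolding G * using h(2) by simp
  also have "\<dots> = d * (n1 * m * h) div (d * c)" using d by simp
  also have "d * (n1 * m * h) = n * m * h" by (subst n1) simp
  finally show "(m * h) * (n * h div d) div gcd (m * h) (n * h div d) = n * m * h div gcd n h"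
    unfolding nh .
qed

text \<open>
  After cancelling \<open>u / t\<close> this says \<open>gcd d (e * t) = G\<close>. One direction uses that \<open>e\<close> divides 2, the other
  a Bezout representation of \<open>e\<close> by \<open>m\<close> and 2 together with \<open>2 m \<tau> = n - 2 u\<close>.
\<close>

lemma gcd_quotients_even_small:
  fixes n u \<tau> m :: int
  assumes n: "n = 2 * u + 2 * m * \<tau>" "n > 0" and u: "u > 0"
  defines "e \<equiv> gcd m 2" and "t \<equiv> gcd u (2 * \<tau>)" and "d \<equiv> gcd n (u - 4 * \<tau>)"
    and "G \<equiv> gcd n (gcd u (4 * \<tau>))"
  shows "gcd (u * d div t) (e * u) = u * G div t"
    and "(u * d div t) * (e * u) div gcd (u * d div t) (e * u) = u * e * d div G"
proof -
  have t: "t > 0" and G: "G > 0" using u n(2) by (simp_all add: t_def G_def)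
  obtain f where f: "u = t * f" unfolding t_def by (meson dvdE gcd_dvd1)
  have f0: "f > 0" using u t unfolding f by (simp add: zero_less_mult_iff)
  have "gcd d (e * t) = G"
  proof (rule zdvd_antisym_nonneg)
    let ?x = "gcd d (e * t)"
    have "?x dvd n" "?x dvd u - 4 * \<tau>"
      by (rule dvd_trans[of _ d], simp, simp add: d_def)+
    moreover have "?x dvd 4 * \<tau>"
    proof -
      have "e * t dvd 2 * (2 * \<tau>)" unfolding e_def t_def by (intro mult_dvd_mono) simp_all
      also have "2 * (2 * \<tau>) = 4 * \<tau>" by simp
      finally show ?thesis by (rule dvd_trans[OF gcd_dvd2])
    qed
    moreover have "u = (u - 4 * \<tau>) + 4 * \<tau>" by simp
    ultimately have "?x dvd u" by (metis dvd_add)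
    then show "?x dvd G" unfolding G_def using \<open>?x dvd n\<close> \<open>?x dvd 4 * \<tau>\<close> by simp
  next
    have x: "G dvd n" "G dvd u" "G dvd 4 * \<tau>" by (simp_all add: G_def dvd_trans[OF gcd_dvd2])
    have "G dvd d" unfolding d_def using x by (intro gcd_greatest dvd_diff)
    moreover have "G dvd e * t"
    proof -
      \<comment> \<open>Write \<open>2 e \<tau>\<close> as \<open>a * 2 m \<tau> + b * 4 \<tau>\<close>, where \<open>2 m \<tau> = n - 2 u\<close>.\<close>
      obtain a b where "a * m + b * 2 = e" unfolding e_def using bezout_int by blast
      then have "e * (2 * \<tau>) = (a * m + b * 2) * (2 * \<tau>)" by simp
      also have "\<dots> = a * (n - 2 * u) + b * (4 * \<tau>)" unfolding n(1) by (simp add: algebra_simps)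
      finally have "G dvd e * (2 * \<tau>)" using x by simp
      then have "G dvd gcd (e * u) (e * (2 * \<tau>))" using x(2) by simp
      also have "gcd (e * u) (e * (2 * \<tau>)) = \<bar>e\<bar> * t"
        unfolding t_def by (rule gcd_mult_distrib_int[symmetric])
      finally show ?thesis by (simp add: e_def)
    qed
    ultimately show "G dvd gcd d (e * t)" by (rule gcd_greatest)
  qed (simp_all add: d_def G_def)
  note dG = this
  have q: "u * d div t = f * d" "u * G div t = f * G" using t unfolding f by simp_all
  have eu: "e * u = f * (e * t)" unfolding f by simp
  have gcd: "gcd (u * d div t) (e * u) = f * G"
    unfolding q eu using gcd_mult_distrib_int[of f d "e * t"] f0 dG by simp
  then show "gcd (u * d div t) (e * u) = u * G div t" unfolding q .
  have *: "(f * d) * (e * u) = f * (u * e * d)" by simp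
  show "(u * d div t) * (e * u) div gcd (u * d div t) (e * u) = u * e * d div G"
    unfolding gcd unfolding q * using f0 by simp
qed

text \<open>
  After cancelling \<open>(m + 4) u\<close> this says \<open>gcd (d * m) (e * n) = \<delta>\<close>, which follows from
  \<open>m (u - 4 \<tau>) = (m + 4) u - 2 n\<close>.
\<close>

lemma gcd_quotients_even_large:
  fixes n u \<tau> m :: int
  assumes n: "n = 2 * u + 2 * m * \<tau>" "n > 0" and u: "u > 0" and m: "m > 0"
  defines "e \<equiv> gcd m 2" and "d \<equiv> gcd n (u - 4 * \<tau>)"
    and "\<delta> \<equiv> gcd (m * n) (gcd ((m + 4) * u) (2 * n))"
  shows "gcd (m * (m + 4) * u div e) (n * (m + 4) * u div d) = ((m + 4) * u * \<delta>) div (d * e)"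
    and "(m * (m + 4) * u div e) * (n * (m + 4) * u div d)
      div gcd (m * (m + 4) * u div e) (n * (m + 4) * u div d) = (n * m * (m + 4) * u) div \<delta>"
proof -
  have e: "e > 0" and d: "d > 0" using m n(2) by (simp_all add: e_def d_def)
  obtain m1 where m1: "m = e * m1" unfolding e_def by (meson dvdE gcd_dvd1)
  obtain n1 where n1: "n = d * n1" unfolding d_def by (meson dvdE gcd_dvd1)
  define c where "c = gcd m1 n1"
  define U where "U = (m + 4) * u"
  have U: "U > 0" using m u by (simp add: U_def)
  have "gcd (d * m) (e * n) = \<delta>"
  proof -
    have dm: "d * m = gcd (m * n) (m * (u - 4 * \<tau>))"
      using gcd_mult_distrib_int[of m n "u - 4 * \<tau>"] m unfolding d_def by (simp add: mult.commute)
    have en: "e * n = gcd (m * n) (2 * n)"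
      using gcd_mult_distrib_int[of n m 2] n(2) unfolding e_def by (simp add: mult.commute)
    have "m * (u - 4 * \<tau>) = (m + 4) * u - 2 * n" unfolding n(1) by (simp add: algebra_simps)
    then have "gcd (m * (u - 4 * \<tau>)) (2 * n) = gcd ((m + 4) * u) (2 * n)"
      by (simp only: gcd_diff1)
    then show ?thesis unfolding dm en \<delta>_def
      by (metis gcd.assoc gcd.commute gcd.left_idem)
  qed
  moreover have "d * m = (d * e) * m1" "e * n = (d * e) * n1"
    by (subst m1, simp, subst n1, simp)
  ultimately have \<delta>: "\<delta> = d * e * c"
    using gcd_mult_distrib_int[of "d * e" m1 n1] d e unfolding c_def by simp
  have q: "m * (m + 4) * u div e = U * m1" "n * (m + 4) * u div d = U * n1"
  proof -
    have "m * (m + 4) * u = e * (U * m1)" unfolding U_def by (subst (1) m1) simp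
    then show "m * (m + 4) * u div e = U * m1" using e by simp
    have "n * (m + 4) * u = d * (U * n1)" unfolding U_def by (subst n1) simp
    then show "n * (m + 4) * u div d = U * n1" using d by simp
  qed
  have gcd: "gcd (m * (m + 4) * u div e) (n * (m + 4) * u div d) = U * c"
    unfolding q c_def using gcd_mult_distrib_int[of U m1 n1] U by simp
  have "(m + 4) * u * \<delta> = (d * e) * (U * c)" unfolding \<delta> U_def by simp
  then show "gcd (m * (m + 4) * u div e) (n * (m + 4) * u div d) = ((m + 4) * u * \<delta>) div (d * e)"
    unfolding gcd using d e by simp
  have "n * m * (m + 4) * u = (d * e) * (m1 * n1 * U)"
    unfolding U_def by (subst n1, subst (1) m1) simp
  then have "n * m * (m + 4) * u div \<delta> = m1 * n1 * U div c" unfolding \<delta> using d e by simp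
  moreover have "(U * m1) * (U * n1) div (U * c) = m1 * n1 * U div c"
  proof -
    have *: "(U * m1) * (U * n1) = U * (m1 * n1 * U)" by simp
    show ?thesis unfolding * using U by simp
  qed
  ultimately show "(m * (m + 4) * u div e) * (n * (m + 4) * u div d)
      div gcd (m * (m + 4) * u div e) (n * (m + 4) * u div d) = (n * m * (m + 4) * u) div \<delta>"
    unfolding gcd unfolding q by simp
qed

section \<open>The critical group\<close>

lemma mset_concat_replicate_pair:
  "mset (concat (replicate k [a, b])) = replicate_mset k a + replicate_mset k b"
  by (induction k) simp_all

lemma gcd_lcm_nonzero:
  fixes a b :: int
  assumes "a \<noteq> 0" "b \<noteq> 0"
  shows "gcd a b \<noteq> 0" "a * b div gcd a b \<noteq> 0"
proof -
  show "gcd a b \<noteq> 0" using assms by simp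
  have "gcd a b * (a * b div gcd a b) = a * b" by (simp add: dvd_mult_div_cancel)
  then show "a * b div gcd a b \<noteq> 0" using assms by (metis mult_eq_0_iff)
qed

text \<open>
  The cokernel has the moduli \<open>h\<close> and \<open>m h\<close>, each \<open>m - 2\<close> times, from the equal summands, and
  \<open>0\<close>, \<open>h\<close>, \<open>gcd n g\<close> and \<open>n h / gcd n g\<close> from the exceptional one. The claimed list arises by replacing one pair
  \<open>m h\<close>, \<open>n h / gcd n g\<close> by its gcd \<open>\<gamma>\<close> and lcm \<open>\<phi>\<close>.
\<close>

lemma critical_group_odd:
  fixes m n s :: nat
  assumes m: "m \<ge> 3" and n: "n \<ge> 3" and s: "n = 2 * s + 1"
  defines "h \<equiv> h_seq m (int s)" and "g \<equiv> g_seq m (int s)"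
  defines "\<gamma> \<equiv> (h div gcd (int n) g) * gcd (int n) h"
    and "\<phi> \<equiv> (int n * int m * h) div gcd (int n) h"
  shows "critical_group (with_proj (prism m n)) \<cong>
    cyclic_sum ([gcd (int n) g, h] @ replicate (m - 2) h @ [\<gamma>] @ replicate (m - 3) (int m * h) @ [\<phi>])"
proof -
  let ?k = "int n * h div gcd (int n) g"
  have m0: "m > 0" using m by simp
  have h: "h > 0" using u_seq_pos[OF m0, of "Suc s"] u_seq_mono[OF m0, of s]
    by (simp add: h_def h_seq_def add.commute)
  have h_eq: "h = int n - int m * g"
    using m_times_tau_seq[OF m0, of "int s"] m_times_tau_seq[OF m0, of "int s + 1"]
    by (simp add: h_def g_def s h_seq_def g_seq_def algebra_simps)
  have k0: "?k \<noteq> 0"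
  proof -
    have "gcd (int n) g dvd int n * h" by simp
    moreover have "int n * h \<noteq> 0" using h n by simp
    ultimately show ?thesis by (metis dvd_div_eq_0_iff)
  qed
  note arith = gcd_quotients_odd[OF h_eq h, folded \<gamma>_def \<phi>_def]
  have n0: "int n > 0" using n by simp
  obtain k where k: "m - 2 = Suc k" "m - 3 = k" using m by (cases "m - 2") auto
  have "quot_cyclic (laplacian_lattice (with_proj (prism m n)))
      ((0 # [h, gcd (int n) g, ?k]) @ concat (replicate (m - 2) [int m * h, h]))"
    using quot_cyclic_quad_odd[OF m0, of s] quot_cyclic_geo_sum_odd[OF m0, of s]
    unfolding s[symmetric] h_def[symmetric] g_def[symmetric]
    by (intro quot_cyclic_prism[OF m n] quot_cyclic_split_augmentation)
  then have "quot_cyclic (laplacian_lattice (with_proj (prism m n)))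
      (int m * h # ?k # [0, h, gcd (int n) g] @ concat (replicate k [int m * h, h]) @ [h])"
    by (rule quot_cyclic_mset) (simp add: k)
  from quot_cyclic_gcd_lcm[OF this]
  have "quot_cyclic (laplacian_lattice (with_proj (prism m n)))
      (\<gamma> # \<phi> # [0, h, gcd (int n) g] @ concat (replicate k [int m * h, h]) @ [h])"
    using arith[OF n0] h m0 by simp
  then have "quot_cyclic (laplacian_lattice (with_proj (prism m n)))
      (0 # [gcd (int n) g, h] @ replicate (m - 2) h @ [\<gamma>] @ replicate (m - 3) (int m * h) @ [\<phi>])"
    by (rule quot_cyclic_mset) (simp add: k mset_concat_replicate_pair)
  moreover have "\<gamma> \<noteq> 0" "\<phi> \<noteq> 0"
    using gcd_lcm_nonzero[OF _ k0, of "int m * h"] arith[OF n0] h m0 by simp_all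
  ultimately show ?thesis
    using h m0 n by (intro critical_group_iso) simp_all
qed

text \<open>
  With \<open>t = gcd u (2 \<tau>)\<close> and \<open>d = gcd n (u - 4 \<tau>)\<close>, the exceptional summand has the moduli \<open>0\<close>,
  \<open>t\<close>, \<open>u d / t\<close> and \<open>n (m + 4) u / d\<close>. Replacing \<open>u d / t\<close> and one \<open>gcd m 2 * u\<close> by gcd and lcm gives
  \<open>\<zeta>\<close> and \<open>\<eta>\<close>; doing the same with \<open>n (m + 4) u / d\<close> and one \<open>\<chi>\<close> gives \<open>\<rho>\<close> and \<open>\<xi>\<close>.
\<close>

lemma critical_group_even:
  fixes m n s :: nat
  assumes m: "m \<ge> 3" and n: "n \<ge> 3" and s: "n = 2 * s"
  defines "u \<equiv> u_seq m (int s)" and "\<tau> \<equiv> tau_seq m (int s)"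
  defines "\<zeta> \<equiv> (u * gcd (int n) (gcd u (4 * \<tau>))) div gcd u (2 * \<tau>)"
    and "\<eta> \<equiv> (u * gcd (int m) 2 * gcd (int n) (u - 4 * \<tau>)) div gcd (int n) (gcd u (4 * \<tau>))"
    and "\<delta> \<equiv> gcd (int m * int n) (gcd ((int m + 4) * u) (2 * int n))"
  defines "\<rho> \<equiv> ((int m + 4) * u * \<delta>) div (gcd (int n) (u - 4 * \<tau>) * gcd (int m) 2)"
    and "\<chi> \<equiv> (int m * (int m + 4) * u) div gcd (int m) 2"
    and "\<xi> \<equiv> (int n * int m * (int m + 4) * u) div \<delta>"
  shows "critical_group (with_proj (prism m n)) \<cong>
    cyclic_sum ([gcd u (2 * \<tau>), \<zeta>] @ replicate (m - 3) (gcd (int m) 2 * u) @ [\<eta>, \<rho>]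
      @ replicate (m - 3) \<chi> @ [\<xi>])"
proof -
  let ?t = "gcd u (2 * \<tau>)" and ?d = "gcd (int n) (u - 4 * \<tau>)" and ?e = "gcd (int m) 2"
  let ?a = "u * ?d div ?t" and ?b = "int n * (int m + 4) * u div ?d"
  let ?Q = "quot_cyclic (laplacian_lattice (with_proj (prism m n)))"
  have m0: "m > 0" and s0: "s > 0" and n0: "int n > 0" using m n s by simp_all
  have u: "u > 0" unfolding u_def by (rule u_seq_pos[OF m0 s0])
  have n_eq: "int n = 2 * u + 2 * int m * \<tau>"
    using m_times_tau_seq[OF m0, of "int s"] by (simp add: u_def \<tau>_def s)
  note small = gcd_quotients_even_small[OF n_eq n0 u, folded \<zeta>_def \<eta>_def]
  note large = gcd_quotients_even_large[OF n_eq n0 u, folded \<delta>_def \<chi>_def, folded \<rho>_def \<xi>_def]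
  have nz: "?a \<noteq> 0" "?e * u \<noteq> 0" "?b \<noteq> 0" "\<chi> \<noteq> 0"
  proof -
    have "?t dvd u * ?d" "?d dvd int n * (int m + 4) * u" by (simp_all add: dvd_mult2)
    then show "?a \<noteq> 0" "?b \<noteq> 0" using u n0 by (simp_all add: dvd_div_eq_0_iff)
    have "?e dvd int m * (int m + 4) * u" by (simp add: dvd_mult2)
    then show "\<chi> \<noteq> 0" unfolding \<chi>_def using u m0 by (simp add: dvd_div_eq_0_iff)
    show "?e * u \<noteq> 0" using u by simp
  qed
  obtain k where k: "m - 2 = Suc k" "m - 3 = k" using m by (cases "m - 2") auto
  have "?Q ((0 # [?a, ?b, ?t]) @ concat (replicate (m - 2) [?e * u, \<chi>]))"
    using quot_cyclic_quad_even[OF m0 s0] quot_cyclic_geo_sum_even[OF m0 s0]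
    unfolding s[symmetric] u_def[symmetric] \<tau>_def[symmetric] \<chi>_def[symmetric]
    by (intro quot_cyclic_prism[OF m n] quot_cyclic_split_augmentation) (simp_all add: s)
  then have "?Q (?a # ?e * u # [0, ?b, ?t, \<chi>] @ concat (replicate k [?e * u, \<chi>]))"
    by (rule quot_cyclic_mset) (simp add: k)
  from quot_cyclic_gcd_lcm[OF this nz(1)]
  have "?Q (\<zeta> # \<eta> # [0, ?b, ?t, \<chi>] @ concat (replicate k [?e * u, \<chi>]))"
    unfolding small(2) unfolding small(1) .
  then have "?Q (\<chi> # ?b # [\<zeta>, \<eta>, 0, ?t] @ concat (replicate k [?e * u, \<chi>]))"
    by (rule quot_cyclic_mset) simp
  from quot_cyclic_gcd_lcm[OF this nz(4)]
  have "?Q (\<rho> # \<xi> # [\<zeta>, \<eta>, 0, ?t] @ concat (replicate k [?e * u, \<chi>]))"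
    using large m0 by simp
  then have "?Q (0 # [?t, \<zeta>] @ replicate (m - 3) (?e * u) @ [\<eta>, \<rho>] @ replicate (m - 3) \<chi> @ [\<xi>])"
    by (rule quot_cyclic_mset) (simp add: k mset_concat_replicate_pair)
  moreover have "\<zeta> \<noteq> 0" "\<eta> \<noteq> 0"
    using gcd_lcm_nonzero[OF nz(1,2)] unfolding small(2) unfolding small(1) by simp_all
  moreover have "\<rho> \<noteq> 0" "\<xi> \<noteq> 0"
    using gcd_lcm_nonzero[OF nz(4,3)] large m0 by simp_all
  ultimately show ?thesis
    using nz u by (intro critical_group_iso) simp_all
qed

theorem theorem1p1:
  fixes m n :: nat
  assumes "m \<ge> 3" and "n \<ge> 3"
  shows
    "(\<forall>s::nat. n = 2 * s + 1 \<longrightarrow>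
       (let h = h_seq m (int s); g = g_seq m (int s);
            \<gamma> = (h div gcd (int n) g) * gcd (int n) h;
            \<phi> = (int n * int m * h) div gcd (int n) h
        in critical_group (with_proj (cartesian_product (complete_graph m) (cycle_graph n)))
           \<cong> cyclic_sum
               ([gcd (int n) g, h] @ replicate (m - 2) h @ [\<gamma>]
                @ replicate (m - 3) (int m * h) @ [\<phi>])))
     \<and>
     (\<forall>s::nat. n = 2 * s \<longrightarrow>
       (let u = u_seq m (int s); \<tau> = tau_seq m (int s);
            \<zeta> = (u * gcd (int n) (gcd u (4 * \<tau>))) div gcd u (2 * \<tau>);
            \<eta> = (u * gcd (int m) 2 * gcd (int n) (u - 4 * \<tau>))
                  div gcd (int n) (gcd u (4 * \<tau>));
            \<delta> = gcd (int m * int n) (gcd ((int m + 4) * u) (2 * int n));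
            \<rho> = ((int m + 4) * u * \<delta>) div (gcd (int n) (u - 4 * \<tau>) * gcd (int m) 2);
            \<chi> = (int m * (int m + 4) * u) div gcd (int m) 2;
            \<xi> = (int n * int m * (int m + 4) * u) div \<delta>
        in critical_group (with_proj (cartesian_product (complete_graph m) (cycle_graph n)))
           \<cong> cyclic_sum
               ([gcd u (2 * \<tau>), \<zeta>] @ replicate (m - 3) (gcd (int m) 2 * u) @ [\<eta>, \<rho>]
                @ replicate (m - 3) \<chi> @ [\<xi>])))"
  unfolding Let_def using critical_group_odd[OF assms] critical_group_even[OF assms] by blast

end
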